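(* Every planar graph that contains no cycle of length $4$ (as a subgraph, not necessarily induced) is $(3,1)$-choosable.
   Context: Graphs are finite and simple. A list assignment $L$ on a graph $G$ assigns to each vertex $v$ a set $L(v)$ of colors. An $L$-coloring of $G$ is a function $\varphi$ on $V(G)$ with $\varphi(v)\in L(v)$ for every vertex $v$ and $\varphi(x)\neq\varphi(y)$ for every edge $xy$. A graph $G$ is $(k,d)$-choosable if $G$ has an $L$-coloring for every list assignment $L$ such that $|L(v)|\ge k$ for every vertex $v$ and $|L(x)\cap L(y)|\le d$ for every edge $xy$ of $G$. *)

theory Defs
  imports "HOL-Analysis.Analysis" "Graph_Theory.Graph_Theory"
begin

(* Finite simple graphs are rendered by the locale pair_graph: an undirected edge xy is the
   pair of opposite arcs (x,y) and (y,x). *)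

section \<open>Planarity\<close>

(* A crossing-free drawing in the plane (the complex numbers). Both arcs of an undirected edge
   must carry the same curve, traversed in opposite directions. A curve meets the vertex points
   only in its two ends, and the curves of two distinct edges meet at most in the images of
   common end vertices. *)
definition plane_drawing ::
  "'a pair_pre_digraph \<Rightarrow> ('a \<Rightarrow> complex) \<Rightarrow> ('a \<times> 'a \<Rightarrow> real \<Rightarrow> complex) \<Rightarrow> bool" where
  "plane_drawing G pos curve \<longleftrightarrow>
     inj_on pos (pverts G) \<and>
     (\<forall>(x, y) \<in> parcs G.
        arc (curve (x, y)) \<and>
        pathstart (curve (x, y)) = pos x \<and>
        pathfinish (curve (x, y)) = pos y \<and>
        curve (y, x) = reversepath (curve (x, y)) \<and>
        path_image (curve (x, y)) \<inter> pos ` pverts G = {pos x, pos y}) \<and>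
     (\<forall>(x, y) \<in> parcs G. \<forall>(u, v) \<in> parcs G. {x, y} \<noteq> {u, v} \<longrightarrow>
        path_image (curve (x, y)) \<inter> path_image (curve (u, v)) \<subseteq> pos ` ({x, y} \<inter> {u, v}))"

definition planar :: "'a pair_pre_digraph \<Rightarrow> bool" where
  "planar G \<longleftrightarrow> (\<exists>pos curve. plane_drawing G pos curve)"

section \<open>List colouring with separation\<close>

definition list_coloring ::
  "'a pair_pre_digraph \<Rightarrow> ('a \<Rightarrow> 'c set) \<Rightarrow> ('a \<Rightarrow> 'c) \<Rightarrow> bool" where
  "list_coloring G L \<phi> \<longleftrightarrow>
     (\<forall>v \<in> pverts G. \<phi> v \<in> L v) \<and> (\<forall>(x, y) \<in> parcs G. \<phi> x \<noteq> \<phi> y)"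

(* Lists may be infinite. Since card is 0 on infinite sets, the cardinality bounds treat that
   case separately. The type argument is the type of colors, which a definition cannot
   quantify over; results are to be stated for an arbitrary one. *)
definition choosable :: "'c itself \<Rightarrow> 'a pair_pre_digraph \<Rightarrow> nat \<Rightarrow> nat \<Rightarrow> bool" where
  "choosable (_ :: 'c itself) G k d \<longleftrightarrow>
     (\<forall>L :: 'a \<Rightarrow> 'c set.
        (\<forall>v \<in> pverts G. infinite (L v) \<or> k \<le> card (L v)) \<and>
        (\<forall>(x, y) \<in> parcs G. finite (L x \<inter> L y) \<and> card (L x \<inter> L y) \<le> d)
        \<longrightarrow> (\<exists>\<phi>. list_coloring G L \<phi>))"

end

theory Submission
  imports Defs
begin

text \<open>
The proof splits into a topological and a combinatorial half, joined by one inequality. In a plane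
graph without four-cycles, every nonempty set \<open>Y\<close> of vertices satisfies
\<open>3 e(Y) + 5 \<le> 5 |Y| + 2 t(Y)\<close>, where \<open>e(Y)\<close> and \<open>t(Y)\<close> count the edges and the triangles inside
\<open>Y\<close> (\<open>drawn_hereditarily_sparse\<close>). Conversely, every graph with this property whose triangles are
pairwise edge-disjoint can be coloured from lists of three colours if adjacent lists share at most
one colour (\<open>list_colouring\<close>); planarity enters nowhere else.

The inequality is an instance of discharging by Euler's formula. It suffices to treat graphs in
which every vertex set sends at least two edges to its complement, as others fall apart into
two smaller graphs joined by at most one edge. A drawing with \<open>n\<close> vertices and \<open>e\<close> edges has at least
\<open>e - n + 2\<close> faces (\<open>many_faces\<close>), and each edge borders at most two of them
(\<open>two_faces_per_edge\<close>). If at most four edges border a face, then peeling off pendant edges, which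
never separate the plane, leaves a triangle, because there is no four-cycle; hence the face fills
one side of this triangle (\<open>small_face\<close>). Each triangle is filled from inside by at most one face,
and only one face can reach infinity, so there are at most \<open>t + 1\<close> such faces, each bordered by
at least three edges. Counting the pairs of a face and an edge on its border gives
\<open>5 (e - n + 2) - 2 (t + 1) \<le> 2 e\<close>. The topology rests on the Jordan curve theorem and on Janiszewski's
theorem.

For the colouring, the idea is to let each vertex be charged for its constraints. If a vertex \<open>u\<close> is
willing to avoid the common colour of \<open>L u\<close> and \<open>L w\<close>, the edge \<open>uw\<close> is settled at the price of one
colour of \<open>u\<close> and at no price for \<open>w\<close>. A triangle, treated as one constraint on three
vertices, is settled at the price of one colour for each of its two later vertices
(\<open>bad_one\<close>): the second vertex avoids the colour of the first one, or the colour that would block a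
second colour of the third vertex, and these coincide when both matter. So a constraint \<open>i\<close> costs
\<open>|i| - 1\<close> in total, and a vertex can afford to pay for two constraints. Edges taken singly would make
a triangle cost three instead of two, which is why triangles are bundled.

Bundling needs an order of the vertices in which each bundled triangle is begun by the vertex that
does not pay for it. Such an order exists if the bundled triangles form a hyperforest
(\<open>hyperforest_rank\<close>). For a maximal hyperforest \<open>\<D>\<close> of triangles, the inequality applied to the classes
of its components yields \<open>e \<le> 2 n + |\<D>|\<close> (\<open>edge_bound\<close>), which says that the total cost is at most
\<open>2 n\<close>. An extremal choice and Hall's theorem then give a proper subset \<open>X\<close> of the vertices and a choice of
payers such that every vertex outside \<open>X\<close> pays for at most two constraints (\<open>orientation\<close>).
The set \<open>X\<close> is coloured by induction and the other vertices greedily. Since a bundled triangle may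
meet \<open>X\<close> in two vertices, the induction must also respect constraints on the edges of a forest, which are
stronger than being different but still exclude only one colour for each colour of
the other end; this is the form in which \<open>colouring_with_forest\<close> is proved.
\<close>

(* The topological predicate is meant throughout, not the one for digraphs. *)
hide_const (open) Digraph_Component.connected

section \<open>Faces along an arc of a Jordan curve\<close>

lemma loop_of_arcs:
  fixes g h :: "real \<Rightarrow> complex"
  assumes "arc g" "arc h" "pathstart h = pathfinish g" "pathfinish h = pathstart g"
    "path_image g \<inter> path_image h \<subseteq> {pathstart g, pathfinish g}"
  defines "J \<equiv> path_image g \<union> path_image h"
  shows "compact J" "open (inside J)" "connected (inside J)" "open (outside J)"
    "connected (outside J)" "\<not> bounded (outside J)" "bounded (inside J)"
    "inside J \<inter> outside J = {}" "inside J \<union> outside J = - J"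
    "frontier (inside J) = J" "frontier (outside J) = J"
proof -
  have s: "simple_path (g +++ h)"
    using assms by (intro simple_path_join_loop) auto
  have J: "path_image (g +++ h) = J"
    unfolding J_def using assms(3) by (simp add: path_image_join)
  have c: "pathfinish (g +++ h) = pathstart (g +++ h)"
    using assms(4) by simp
  show "compact J" using compact_simple_path_image[OF s] J by simp
  show "open (inside J)" "connected (inside J)" "open (outside J)"
    "connected (outside J)" "\<not> bounded (outside J)" "bounded (inside J)"
    "inside J \<inter> outside J = {}" "inside J \<union> outside J = - J"
    "frontier (inside J) = J" "frontier (outside J) = J"
    using Jordan_inside_outside[OF s c] unfolding J by simp_all
qed

text \<open>
Near a point of \<open>J\<close>, two points on the same side of \<open>J\<close> can be joined without leaving a given small
ball. Neither \<open>J\<close> nor the union of \<open>K\<close> with the outside of the ball separates them, and these two sets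
meet in the connected set \<open>K\<close>, so Janiszewski's theorem applies to their union.
\<close>

lemma local_connection:
  fixes p :: complex
  assumes "compact J" "closed K" "connected K" "K \<subseteq> J" "p \<notin> K" "J - K \<subseteq> ball p \<epsilon>" "\<epsilon> > 0"
  obtains \<delta> where "\<delta> > 0" "\<And>u v. \<lbrakk>u \<in> ball p \<delta>; v \<in> ball p \<delta>; connected_component (- J) u v\<rbrakk>
     \<Longrightarrow> connected_component (ball p \<epsilon> - J) u v"
proof -
  have "open (ball p \<epsilon> - K)" using assms(2) by (simp add: open_Diff)
  moreover have "p \<in> ball p \<epsilon> - K" using assms by simp
  ultimately obtain \<delta> where d: "\<delta> > 0" "ball p \<delta> \<subseteq> ball p \<epsilon> - K"
    using open_contains_ball by meson
  define T where "T = K \<union> - ball p \<epsilon>"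
  have JT: "J \<inter> T = K" using assms(4,6) unfolding T_def by blast
  have cT: "closed T" unfolding T_def using assms(2) by (intro closed_Un) auto
  show thesis
  proof (rule that[OF d(1)])
    fix u v assume uv: "u \<in> ball p \<delta>" "v \<in> ball p \<delta>" "connected_component (- J) u v"
    have "connected_component (- T) u v"
      unfolding connected_component_def
      using uv d(2) T_def by (intro exI[of _ "ball p \<delta>"]) auto
    then have "connected_component (- (J \<union> T)) u v"
      using Janiszewski[OF assms(1) cT] uv(3) JT assms(3) by simp
    moreover have "- (J \<union> T) = ball p \<epsilon> - J" using assms(4) unfolding T_def by auto
    ultimately show "connected_component (ball p \<epsilon> - J) u v" by simp
  qed
qed

text \<open>
Deleting a short piece around an inner point \<open>p\<close> of the arc \<open>g\<close> leaves the loop connected, since its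
two halves of \<open>g\<close> hang on the arc \<open>h\<close>. This remainder serves as the set \<open>K\<close> of the previous lemma.
\<close>

lemma local_connection_at_arc:
  fixes g h :: "real \<Rightarrow> complex"
  assumes gh: "arc g" "arc h" "pathstart h = pathfinish g" "pathfinish h = pathstart g"
    "path_image g \<inter> path_image h \<subseteq> {pathstart g, pathfinish g}"
    and p: "p \<in> path_image g" "p \<noteq> pathstart g" "p \<noteq> pathfinish g" and "\<epsilon> > 0"
  obtains \<delta> where "\<delta> > 0" "\<And>u v. \<lbrakk>u \<in> ball p \<delta>; v \<in> ball p \<delta>;
       connected_component (- (path_image g \<union> path_image h)) u v\<rbrakk>
     \<Longrightarrow> connected_component (ball p \<epsilon> - (path_image g \<union> path_image h)) u v"
proof -
  have cg: "continuous_on {0..1} g" and inj: "inj_on g {0..1}"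
    using gh(1) by (auto simp: arc_def path_def)
  obtain t where t: "0 \<le> t" "t \<le> 1" "g t = p" using p(1) by (auto simp: path_image_def)
  have t': "0 < t" "t < 1" using t p(2,3)
    by (auto simp: pathstart_def pathfinish_def less_le)
  obtain \<eta> where e: "\<eta> > 0" "\<And>s. s \<in> {0..1} \<Longrightarrow> dist s t < \<eta> \<Longrightarrow> dist (g s) p < \<epsilon>"
    using cg t \<open>\<epsilon> > 0\<close> unfolding continuous_on_iff by (metis atLeastAtMost_iff)
  (* Half of the modulus of continuity, and small enough to stay inside the parameter interval. *)
  define k where "k = min (\<eta>/2) (min (t/2) ((1-t)/2))"
  have k: "k > 0" "k < \<eta>" "k < t" "t + k < 1" using e(1) t' by (auto simp: k_def min_def field_simps)
  define K where "K = (g ` {0..t-k} \<union> path_image h) \<union> g ` {t+k..1}"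
  have conn: "connected (g ` {0..t-k})" "connected (g ` {t+k..1})"
    using k t' by (auto intro!: connected_continuous_image continuous_on_subset[OF cg])
  have comp: "compact (g ` {0..t-k})" "compact (g ` {t+k..1})"
    using k t' by (auto intro!: compact_continuous_image continuous_on_subset[OF cg])
  have "g 0 \<in> path_image h" "g 1 \<in> path_image h"
    using gh(3,4) pathstart_in_path_image[of h] pathfinish_in_path_image[of h]
    by (auto simp: pathstart_def pathfinish_def)
  moreover have "g 0 \<in> g ` {0..t-k}" "g 1 \<in> g ` {t+k..1}" using k by auto
  ultimately have cK: "connected K" unfolding K_def
    using conn connected_arc_image[OF gh(2)] by (intro connected_Un) auto
  have clK: "closed K" unfolding K_def
    using comp gh(2) by (intro closed_Un) (auto simp: compact_imp_closed closed_arc_image)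
  have pK: "p \<notin> K"
  proof
    assume "p \<in> K"
    then have "p \<in> g ` {0..t-k} \<or> p \<in> g ` {t+k..1}" using gh(5) p unfolding K_def by auto
    then obtain s where "s \<in> {0..t-k} \<union> {t+k..1}" "g s = p" by blast
    then have "s \<in> {0..1}" "s \<noteq> t" "g s = p" using k t by auto
    then show False using inj t by (auto simp: inj_on_def)
  qed
  have sub: "path_image g \<union> path_image h - K \<subseteq> ball p \<epsilon>"
  proof
    fix x assume x: "x \<in> path_image g \<union> path_image h - K"
    then obtain s where s: "s \<in> {0..1}" "x = g s" by (auto simp: K_def path_image_def)
    with x have "t - k < s" "s < t + k" by (auto simp: K_def image_iff not_less)
    then have "dist s t < \<eta>" using k by (auto simp: dist_real_def)
    then show "x \<in> ball p \<epsilon>" using e(2) s by (simp add: dist_commute)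
  qed
  have KJ: "K \<subseteq> path_image g \<union> path_image h"
    unfolding K_def path_image_def using k t' by auto
  show thesis
    using local_connection[OF loop_of_arcs(1)[OF gh] clK cK KJ pK sub \<open>\<epsilon> > 0\<close>] that by blast
qed

text \<open>
A face of the plane minus \<open>D\<close> that lies on the side \<open>K\<close> of the loop and touches the open arc \<open>A\<close>
somewhere touches it everywhere, and near \<open>A\<close> it contains that whole side: the first property is
open and closed along \<open>A\<close> by local connection. Consequently at most one face on each side touches \<open>A\<close>.
\<close>

lemma face_along_arc:
  fixes g h :: "real \<Rightarrow> complex" and D :: "complex set"
  assumes gh: "arc g" "arc h" "pathstart h = pathfinish g" "pathfinish h = pathstart g"
    "path_image g \<inter> path_image h \<subseteq> {pathstart g, pathfinish g}"
  defines "J \<equiv> path_image g \<union> path_image h"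
    and "A \<equiv> path_image g - {pathstart g, pathfinish g}"
  assumes JD: "J \<subseteq> D" and clD: "closed (D - A)"
    and K: "connected K" "K \<subseteq> - J" "frontier K = J"
    and f: "f \<in> components (- D)" "f \<subseteq> K" and p: "p \<in> A" "p \<in> closure f"
  shows "A \<subseteq> closure f" "\<exists>\<delta>>0. K \<inter> ball p \<delta> \<subseteq> f"
proof -
  have near: "\<exists>\<delta>>0. K \<inter> ball q \<delta> \<subseteq> f" if q: "q \<in> A" "q \<in> closure f" for q
  proof -
    have "open (- (D - A))" using clD by (rule open_Compl)
    moreover have "q \<in> - (D - A)" using q by auto
    ultimately obtain \<epsilon> where e: "\<epsilon> > 0" "ball q \<epsilon> \<subseteq> - (D - A)"
      using open_contains_ball by meson
    obtain \<delta> where d: "\<delta> > 0" "\<And>u v. \<lbrakk>u \<in> ball q \<delta>; v \<in> ball q \<delta>; connected_component (- J) u v\<rbrakk>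
     \<Longrightarrow> connected_component (ball q \<epsilon> - J) u v"
      using local_connection_at_arc[OF gh, of q \<epsilon>] q e(1) unfolding J_def A_def by blast
    obtain u where u: "u \<in> f" "u \<in> ball q \<delta>"
      using q(2) d(1) by (metis closure_approachable dist_commute mem_ball)
    have "v \<in> f" if v: "v \<in> K" "v \<in> ball q \<delta>" for v
    proof -
      have "connected_component (- J) u v"
        unfolding connected_component_def using K u(1) f(2) v by blast
      then have "connected_component (ball q \<epsilon> - J) u v" using d(2) u v by blast
      moreover have "ball q \<epsilon> - J \<subseteq> - D" using e(2) unfolding J_def A_def by blast
      ultimately have "connected_component (- D) u v"
        using connected_component_mono by blast
      then show "v \<in> f" using f(1) u(1)
        by (metis components_iff connected_component_eq mem_Collect_eq)
    qed
    then show ?thesis using d(1) by blast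
  qed
  show "\<exists>\<delta>>0. K \<inter> ball p \<delta> \<subseteq> f" using near p by blast
  have "connected A" unfolding A_def
    using gh(1) by (simp add: arc_imp_simple_path connected_simple_path_endless)
  moreover have "openin (top_of_set A) (A \<inter> closure f)"
    unfolding openin_contains_ball
  proof (intro conjI ballI)
    fix q assume q: "q \<in> A \<inter> closure f"
    then obtain \<delta> where d: "\<delta> > 0" "K \<inter> ball q \<delta> \<subseteq> f" using near by blast
    have "ball q \<delta> \<inter> A \<subseteq> closure f"
    proof
      fix r assume r: "r \<in> ball q \<delta> \<inter> A"
      then have "r \<in> closure K" using K(3) unfolding J_def A_def frontier_def by auto
      then have "r \<in> closure (ball q \<delta> \<inter> K)"
        using r open_Int_closure_subset[of "ball q \<delta>" K] by auto
      then show "r \<in> closure f" using d(2) closure_mono[of "ball q \<delta> \<inter> K" f] by (auto simp: Int_commute)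
    qed
    then show "\<exists>e>0. ball q e \<inter> A \<subseteq> A \<inter> closure f" using d(1) by blast
  qed auto
  moreover have "closedin (top_of_set A) (A \<inter> closure f)" by (simp add: closedin_closed_Int)
  ultimately have "A \<inter> closure f = {} \<or> A \<inter> closure f = A"
    unfolding connected_clopen by blast
  then show "A \<subseteq> closure f" using p by blast
qed

section \<open>Plane drawings of finite graphs\<close>

text \<open>
Edges are two-element sets here, each with a single point set \<open>img\<close> as its picture, so that the two
orientations of an edge need not be distinguished; a parametrisation is chosen when it is needed.
\<close>

locale drawn =
  fixes V :: "'a set" and E :: "'a set set" and pos :: "'a \<Rightarrow> complex"
    and img :: "'a set \<Rightarrow> complex set"
  assumes fin: "finite V" and inj: "inj_on pos V"
    and edge: "e \<in> E \<Longrightarrow> \<exists>a b. e = {a,b} \<and> a \<noteq> b \<and> a \<in> V \<and> b \<in> V"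
    and arc: "{a,b} \<in> E \<Longrightarrow>
        \<exists>g. arc g \<and> pathstart g = pos a \<and> pathfinish g = pos b \<and> path_image g = img {a,b}"
    and img_vertices: "e \<in> E \<Longrightarrow> img e \<inter> pos ` V = pos ` e"
    and img_disjoint: "e \<in> E \<Longrightarrow> e' \<in> E \<Longrightarrow> e \<noteq> e' \<Longrightarrow> img e \<inter> img e' \<subseteq> pos ` (e \<inter> e')"

lemma drawn_subgraph:
  assumes "drawn V E pos img" "V' \<subseteq> V" "E' \<subseteq> E" "\<Union>E' \<subseteq> V'"
  shows "drawn V' E' pos img"
proof -
  interpret drawn V E pos img by fact
  show ?thesis
  proof
    show "finite V'" using fin assms(2) finite_subset by blast
    show "inj_on pos V'" using inj assms(2) inj_on_subset by blast
    fix e assume e: "e \<in> E'"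
    then obtain a b where "e = {a,b}" "a \<noteq> b" using edge assms(3) by blast
    then show "\<exists>a b. e = {a,b} \<and> a \<noteq> b \<and> a \<in> V' \<and> b \<in> V'" using e assms(4) by blast
    have "img e \<inter> pos ` V = pos ` e" using img_vertices e assms(3) by blast
    moreover have "pos ` e \<subseteq> pos ` V'" using e assms(4) by blast
    ultimately show "img e \<inter> pos ` V' = pos ` e" using assms(2) by blast
  next
    fix a b assume "{a,b} \<in> E'" then show "\<exists>g. arc g \<and> pathstart g = pos a \<and> pathfinish g = pos b \<and> path_image g = img {a,b}"
      using arc assms(3) by blast
  next
    fix e e' assume "e \<in> E'" "e' \<in> E'" "e \<noteq> e'" then show "img e \<inter> img e' \<subseteq> pos ` (e \<inter> e')"
      using img_disjoint assms(3) by blast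
  qed
qed

definition adj :: "'a set set \<Rightarrow> ('a \<times> 'a) set" where
  "adj E = {(x,y). {x,y} \<in> E}"

lemma sym_adj: "sym (adj E)" by (auto simp: adj_def sym_def insert_commute)

context drawn begin

lemma finE: "finite E"
proof -
  have "E \<subseteq> Pow V" using edge by fastforce
  then show ?thesis using fin finite_subset by blast
qed

lemma edge_subset: "e \<in> E \<Longrightarrow> e \<subseteq> V" using edge by fastforce

lemma edge_arc:
  assumes "e \<in> E"
  obtains a b g where "e = {a,b}" "a \<noteq> b" "a \<in> V" "b \<in> V" "arc g" "pathstart g = pos a"
    "pathfinish g = pos b" "path_image g = img e"
  using edge[OF assms] arc assms by metis

lemma img_compact: "e \<in> E \<Longrightarrow> compact (img e)"
  by (metis edge_arc compact_arc_image)

lemma img_complement_connected: "e \<in> E \<Longrightarrow> connected (- img e)"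
  by (metis edge_arc connected_arc_complement DIM_complex order_refl)

definition drawing :: "complex set" where "drawing = pos ` V \<union> \<Union>(img ` E)"

lemma drawing_compact: "compact drawing"
  unfolding drawing_def using fin finE img_compact by (intro compact_Un compact_UN) (auto intro: finite_imp_compact)

definition open_edge :: "'a set \<Rightarrow> complex set" where
  "open_edge e = img e - pos ` e"

text \<open>
Removing an open edge from the drawing leaves the drawing of the graph without that edge; in
particular, what remains is closed.
\<close>

lemma open_edge_Diff: assumes "e \<in> E" shows "drawing - open_edge e = pos ` V \<union> \<Union>(img ` (E - {e}))"
proof -
  have "img e \<inter> pos ` V = pos ` e" by (rule img_vertices[OF assms])
  moreover have "pos ` e \<subseteq> pos ` V" using edge_subset[OF assms] by blast
  moreover have "img e \<inter> img e' \<subseteq> pos ` e" if "e' \<in> E - {e}" for e' 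
    using img_disjoint[OF assms, of e'] that by blast
  ultimately show ?thesis unfolding drawing_def open_edge_def using assms by blast
qed

lemma open_edge_closed_Diff: assumes "e \<in> E" shows "closed (drawing - open_edge e)"
  unfolding open_edge_Diff[OF assms] using fin finE img_compact 
  by (intro closed_Un closed_UN) (auto intro: finite_imp_closed compact_imp_closed)

lemma open_edge_nonempty_connected: assumes "e \<in> E" shows "open_edge e \<noteq> {}" "connected (open_edge e)"
proof -
  obtain a b g where g: "e = {a,b}" "a \<noteq> b" "arc g" "pathstart g = pos a"
    "pathfinish g = pos b" "path_image g = img e" using edge_arc[OF assms] by metis
  have "open_edge e = path_image g - {pathstart g, pathfinish g}" unfolding open_edge_def using g by simp
  then show "open_edge e \<noteq> {}" "connected (open_edge e)"
    using nonempty_simple_path_endless[OF arc_imp_simple_path[OF g(3)]]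
      connected_simple_path_endless[OF arc_imp_simple_path[OF g(3)]] by auto
qed

lemma open_edge_in_other:
  assumes "e \<in> E" "p \<in> open_edge e" "p \<in> img e'" "e' \<in> E" shows "e' = e"
proof (rule ccontr)
  assume "e' \<noteq> e"
  then have "p \<in> pos ` e" using img_disjoint[of e e'] assms unfolding open_edge_def by blast
  then show False using assms unfolding open_edge_def by blast
qed

lemma open_edge_not_vertex: assumes "e \<in> E" "p \<in> open_edge e" shows "p \<notin> pos ` V"
  using assms img_vertices[of e] unfolding open_edge_def by blast

lemma path_between:
  assumes "(a,b) \<in> (adj E)\<^sup>*" "a \<noteq> b"
  shows "path_component (\<Union>(img ` E)) (pos a) (pos b)"
proof -
  have "(a,b) \<in> (adj E)\<^sup>+" using assms by (meson rtranclD)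
  then show ?thesis
  proof (induction rule: trancl_induct)
    case (base y)
    then obtain g where "arc g" "pathstart g = pos a" "pathfinish g = pos y" "path_image g = img {a,y}"
      using arc unfolding adj_def by blast
    then show ?case using base unfolding path_component_def adj_def by (metis (mono_tags, lifting) Union_upper arc_imp_path case_prodD imageI mem_Collect_eq)
  next
    case (step y z)
    then obtain g where "arc g" "pathstart g = pos y" "pathfinish g = pos z" "path_image g = img {y,z}"
      using arc unfolding adj_def by blast
    then have "path_component (\<Union>(img ` E)) (pos y) (pos z)"
      using step unfolding path_component_def adj_def by (metis (mono_tags, lifting) Union_upper arc_imp_path case_prodD imageI mem_Collect_eq)
    then show ?case using step path_component_trans by blast
  qed
qed

end

text \<open>
An edge whose ends stay connected without it lies on a Jordan curve within the drawing. The path of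
the remaining graph is taken topologically: any path contains an arc, so no simple path in the
graph has to be constructed.
\<close>

lemma (in drawn) edge_on_loop:
  assumes ab: "{a,b} \<in> E" "(a,b) \<in> (adj (E - {{a,b}}))\<^sup>*"
  obtains g h where "arc g" "arc h" "pathstart h = pathfinish g" "pathfinish h = pathstart g"
    "path_image g \<inter> path_image h \<subseteq> {pathstart g, pathfinish g}" "path_image g = img {a,b}"
    "path_image h \<subseteq> \<Union>(img ` (E - {{a,b}}))" "open_edge {a,b} = path_image g - {pathstart g, pathfinish g}"
proof -
  have ne: "a \<noteq> b" using edge[OF ab(1)] by fastforce
  have V: "a \<in> V" "b \<in> V" using edge_subset[OF ab(1)] by auto
  obtain g where g: "arc g" "pathstart g = pos a" "pathfinish g = pos b" "path_image g = img {a,b}"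
    using arc[OF ab(1)] by blast
  interpret d: drawn V "E - {{a,b}}" pos img
    by (rule drawn_subgraph[OF drawn_axioms]) (use edge_subset in auto)
  obtain q where q: "path q" "path_image q \<subseteq> \<Union>(img ` (E - {{a,b}}))" "pathstart q = pos a" "pathfinish q = pos b"
    using d.path_between[OF ab(2) ne] unfolding path_component_def by blast
  have pne: "pos a \<noteq> pos b" using inj V ne by (meson inj_onD)
  obtain h where h: "arc h" "path_image h \<subseteq> path_image q" "pathstart h = pos a" "pathfinish h = pos b"
    using path_contains_arc[OF q(1,3,4) pne] by blast
  show thesis
  proof (rule that[of g "reversepath h"])
    show "path_image g \<inter> path_image (reversepath h) \<subseteq> {pathstart g, pathfinish g}"
    proof
      fix p assume p: "p \<in> path_image g \<inter> path_image (reversepath h)"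
      then have "p \<in> \<Union>(img ` (E - {{a,b}}))" "p \<in> img {a,b}" using q(2) h(2) g(4) by auto
      then obtain e' where "e' \<in> E - {{a,b}}" "p \<in> img e'" by blast
      then have "p \<in> pos ` ({a,b} \<inter> e')" using \<open>p \<in> img {a,b}\<close> img_disjoint[OF ab(1), of e'] by blast
      then show "p \<in> {pathstart g, pathfinish g}" using g by auto
    qed
  qed (use g h q in \<open>auto simp: arc_reversepath open_edge_def\<close>)
qed

section \<open>A lower bound for the number of faces\<close>

text \<open>
An arc has no interior, by invariance of dimension.
\<close>

lemma component_meets_complement_of_arc:
  fixes g :: "real \<Rightarrow> complex"
  assumes "arc g" "open U" "C \<in> components U"
  shows "C - path_image g \<noteq> {}"
proof
  assume "C - path_image g = {}"
  then have sub: "C \<subseteq> path_image g" by blast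
  obtain h where h: "homeomorphism {0..1} (path_image g) g h" using homeomorphism_arc[OF assms(1)] by blast
  have "continuous_on C h" "inj_on h C"
    using h sub homeomorphism_apply2[OF h] by (auto simp: homeomorphism_def intro: continuous_on_subset) (metis inj_on_def subsetD)
  moreover have "open C" "C \<noteq> {}" using assms(2,3) open_components in_components_nonempty by auto
  ultimately have "DIM(complex) \<le> DIM(real)" using invariance_of_dimension by blast
  then show False by simp
qed

context drawn begin

lemma drawing_closed: "closed drawing" using drawing_compact compact_imp_closed by blast

definition in_distinct_faces :: "complex set \<Rightarrow> bool" where
  "in_distinct_faces R \<longleftrightarrow> finite R \<and> R \<subseteq> - drawing \<and> (\<forall>x\<in>R. \<forall>y\<in>R. x \<noteq> y \<longrightarrow> \<not> connected_component (- drawing) x y)"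

end

text \<open>
This is one half of Euler's formula. The set \<open>S\<close> meets every component of the graph and \<open>R\<close> has at
most one point in each face. Adding an edge between two components saves an element of
\<open>S\<close>; adding an edge within a component closes a Jordan curve, which splits the face containing the
new open edge, so \<open>R\<close> gains a point. The exact number of components or faces is never needed.
\<close>

lemma many_faces:
  assumes "drawn V E pos img"
  shows "\<exists>S R. S \<subseteq> V \<and> (\<forall>v\<in>V. \<exists>s\<in>S. (v,s) \<in> (adj E)\<^sup>*) \<and> drawn.in_distinct_faces V E pos img R \<and>
      card E + card S + 1 \<le> card R + card V"
proof -
  have "finite E" using drawn.finE[OF assms] .
  then show ?thesis using assms
  proof (induction E)
    case empty
    then interpret drawn V "{}" pos img by simp
    obtain r where "r \<notin> pos ` V" using fin ex_new_if_finite[OF infinite_UNIV_char_0, of "pos ` V"] by auto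
    then have "in_distinct_faces {r}" by (auto simp: in_distinct_faces_def drawing_def)
    then show ?case by (intro exI[of _ V] exI[of _ "{r}"]) auto
  next
    case (insert e E)
    interpret n: drawn V "insert e E" pos img by fact
    interpret o: drawn V E pos img
      by (rule drawn_subgraph[OF insert.prems]) (use n.edge_subset in auto)
    obtain S R where SR: "S \<subseteq> V" "\<And>v. v\<in>V \<Longrightarrow> \<exists>s\<in>S. (v,s) \<in> (adj E)\<^sup>*" "o.in_distinct_faces R"
      "card E + card S + 1 \<le> card R + card V"
      using insert.IH[OF o.drawn_axioms] by blast
    obtain a b g where e: "e = {a,b}" "a \<noteq> b" "a \<in> V" "b \<in> V" "arc g" "pathstart g = pos a"
      "pathfinish g = pos b" "path_image g = img e" using n.edge_arc[of e] by blast
    have Dn: "n.drawing = o.drawing \<union> img e" unfolding n.drawing_def o.drawing_def by auto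
    have mono: "(adj E)\<^sup>* \<subseteq> (adj (insert e E))\<^sup>*" by (intro rtrancl_mono) (auto simp: adj_def)
    have finR: "finite R" using SR(3) unfolding o.in_distinct_faces_def by blast
    have finS: "finite S" using SR(1) o.fin finite_subset by blast
    (* The representatives must be moved off the new edge, within their old faces. *)
    define C where "C = (\<lambda>r. connected_component_set (- o.drawing) r)"
    have comp: "C r \<in> components (- o.drawing)" if "r \<in> R" for r
      using that SR(3) unfolding C_def o.in_distinct_faces_def components_def by auto
    have "\<exists>r'. r' \<in> C r - img e" if "r \<in> R" for r
      using component_meets_complement_of_arc[OF e(5) _ comp[OF that]] o.drawing_closed e(8) by auto
    then obtain m where m: "\<And>r. r \<in> R \<Longrightarrow> m r \<in> C r - img e" by metis
    have mC: "connected_component (- o.drawing) r (m r)" if "r \<in> R" for r using m[OF that] unfolding C_def by simp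
    have mdist: "\<not> connected_component (- o.drawing) (m r) (m r')" if "r \<in> R" "r' \<in> R" "r \<noteq> r'" for r r'
      using mC[OF that(1)] mC[OF that(2)] that SR(3) unfolding o.in_distinct_faces_def
      by (meson connected_component_sym connected_component_trans)
    have sub: "connected_component (- n.drawing) x y \<Longrightarrow> connected_component (- o.drawing) x y" for x y
      by (rule connected_component_of_subset) (auto simp: Dn)
    have mD: "m r \<in> - o.drawing" if "r \<in> R" for r using mC[OF that] connected_component_in by blast
    have inj: "inj_on m R"
    proof (rule inj_onI, rule ccontr)
      fix r r' assume "r \<in> R" "r' \<in> R" "m r = m r'" "r \<noteq> r'"
      then show False using mdist[of r r'] mD[of r'] by (simp add: connected_component_refl)
    qed
    have sepm: "n.in_distinct_faces (m ` R')" if "R' \<subseteq> R" for R' unfolding n.in_distinct_faces_def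
    proof (intro conjI ballI impI)
      show "finite (m ` R')" using finR that finite_subset by blast
      show "m ` R' \<subseteq> - n.drawing" using m mD that unfolding Dn by blast
      fix x y assume "x \<in> m ` R'" "y \<in> m ` R'" "x \<noteq> y"
      then show "\<not> connected_component (- n.drawing) x y" using mdist sub that by blast
    qed
    show ?case
    proof (cases "(a,b) \<in> (adj E)\<^sup>*")
      case True
      have E: "insert e E - {{a,b}} = E" using insert.hyps e(1) by auto
      obtain g h where gh: "arc g" "arc h" "pathstart h = pathfinish g" "pathfinish h = pathstart g"
        "path_image g \<inter> path_image h \<subseteq> {pathstart g, pathfinish g}" "path_image g = img e"
        "path_image h \<subseteq> \<Union>(img ` E)" "n.open_edge e = path_image g - {pathstart g, pathfinish g}"
        using n.edge_on_loop[of a b] True e(1) E by auto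
      define J where "J = path_image g \<union> path_image h"
      note J = loop_of_arcs[OF gh(1-5), folded J_def]
      have Jn: "J \<subseteq> n.drawing" unfolding J_def Dn o.drawing_def using gh by auto
      obtain p where p: "p \<in> n.open_edge e" using n.open_edge_nonempty_connected[of e] by blast
      have poD: "p \<notin> o.drawing"
        using n.open_edge_Diff[of e] E e(1) p unfolding o.drawing_def by auto
      define f where "f = C p"
      have fo: "open f" unfolding f_def C_def using o.drawing_closed by (simp add: open_Compl open_connected_component)
      have pf: "p \<in> f" unfolding f_def C_def using poD by simp
      have pJ: "p \<in> closure (inside J)" "p \<in> closure (outside J)"
        using p gh(8) J(10,11) unfolding J_def by (auto simp: frontier_def)
      have "f \<inter> inside J \<noteq> {}" "f \<inter> outside J \<noteq> {}"
        using pJ open_Int_closure_eq_empty[OF fo] pf by blast+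
      then obtain x y where xy: "x \<in> f" "x \<in> inside J" "y \<in> f" "y \<in> outside J" by blast
      have fD: "f \<subseteq> - o.drawing" unfolding f_def C_def using connected_component_subset by blast
      have xyD: "x \<in> - n.drawing" "y \<in> - n.drawing" using xy J(9) fD gh(6) unfolding Dn J_def by blast+
      have nxy: "\<not> connected_component (- n.drawing) x y"
      proof
        assume "connected_component (- n.drawing) x y"
        then have cc: "connected_component (- J) x y" by (rule connected_component_of_subset) (use Jn in auto)
        then obtain T where T: "connected T" "T \<subseteq> - J" "x \<in> T" "y \<in> T" unfolding connected_component_def by blast
        have "T \<subseteq> inside J \<union> outside J" using T(2) J(9) by simp
        moreover have "inside J \<inter> outside J \<inter> T = {}" using J(8) by blast
        ultimately have "inside J \<inter> T = {} \<or> outside J \<inter> T = {}"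
          using T(1) J(2,4) by (meson connectedD)
        then show False using T xy by blast
      qed
      (* The representative of the split face, if there is one, gives way to a point on each side. *)
      define R' where "R' = {r\<in>R. \<not> connected_component (- o.drawing) p r}"
      have xp: "connected_component (- o.drawing) p x" "connected_component (- o.drawing) p y"
        using xy unfolding f_def C_def by auto
      have notm: "\<not> connected_component (- o.drawing) p (m r)" if "r \<in> R'" for r
        using that mC[of r] unfolding R'_def by (blast intro: connected_component_trans connected_component_sym)
      have far: "\<not> connected_component (- n.drawing) z (m r)" "\<not> connected_component (- n.drawing) (m r) z" if "r \<in> R'" "z \<in> {x,y}" for r z
        using sub notm[OF that(1)] xp that(2) by (blast intro: connected_component_trans connected_component_sym)+
      have "n.in_distinct_faces (insert x (insert y (m ` R')))"
        using sepm[of R'] xyD nxy far connected_component_sym[of "- n.drawing" y x] unfolding n.in_distinct_faces_def R'_def by auto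
      moreover have "card R < card (insert x (insert y (m ` R')))"
      proof -
        have fR': "finite R'" using finR unfolding R'_def by simp
        have "x \<noteq> y" using nxy xyD by auto
        moreover have "x \<notin> m ` R'" "y \<notin> m ` R'" using notm xp by auto
        ultimately have c: "card (insert x (insert y (m ` R'))) = card R' + 2"
          using fR' inj by (subst card_insert_disjoint; simp add: card_image inj_on_def R'_def)+
        have "card (R - R') \<le> Suc 0"
        proof (subst card_le_Suc0_iff_eq)
          show "finite (R - R')" using finR by simp
          show "\<forall>a1\<in>R - R'. \<forall>a2\<in>R - R'. a1 = a2"
            using SR(3) unfolding R'_def o.in_distinct_faces_def
            by (metis (no_types, lifting) DiffE connected_component_sym connected_component_trans mem_Collect_eq)
        qed
        moreover have "card R = card R' + card (R - R')"
          using finR fR' by (metis R'_def card_Diff_subset card_mono le_add_diff_inverse mem_Collect_eq subsetI)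
        ultimately show ?thesis using c by linarith
      qed
      moreover have "\<forall>v\<in>V. \<exists>s\<in>S. (v, s) \<in> (adj (insert e E))\<^sup>*" using SR(2) mono by blast
      ultimately show ?thesis using SR(1,4) insert.hyps
        by (intro exI[of _ S] exI[of _ "insert x (insert y (m ` R'))"]) auto
    next
      case False
      obtain sa sb where s: "sa \<in> S" "(a,sa) \<in> (adj E)\<^sup>*" "sb \<in> S" "(b,sb) \<in> (adj E)\<^sup>*"
        using SR(2) e(3,4) by metis
      have symr: "(x,y) \<in> (adj F)\<^sup>* \<Longrightarrow> (y,x) \<in> (adj F)\<^sup>*" for x y and F :: "'a set set"
        using sym_rtrancl[OF sym_adj] by (meson symE)
      have ne: "sa \<noteq> sb" using s False symr by (metis rtrancl_trans)
      have st: "(b,a) \<in> adj (insert e E)" unfolding adj_def e(1) by (auto simp: insert_commute)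
      have con: "(sb, sa) \<in> (adj (insert e E))\<^sup>*"
      proof -
        have "(sb,b) \<in> (adj (insert e E))\<^sup>*" "(a,sa) \<in> (adj (insert e E))\<^sup>*" using symr[OF s(4)] s(2) mono by blast+
        then show ?thesis using st by (meson rtrancl.rtrancl_into_rtrancl rtrancl_trans)
      qed
      have "\<forall>v\<in>V. \<exists>s\<in>S - {sb}. (v, s) \<in> (adj (insert e E))\<^sup>*"
      proof
        fix v assume "v \<in> V"
        then obtain s' where s': "s' \<in> S" "(v,s') \<in> (adj (insert e E))\<^sup>*" using SR(2) mono by blast
        show "\<exists>s\<in>S - {sb}. (v, s) \<in> (adj (insert e E))\<^sup>*"
        proof (cases "s' = sb")
          case True then show ?thesis using s' con ne s(1) by (intro bexI[of _ sa]) auto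
        next
          case False then show ?thesis using s' by blast
        qed
      qed
      moreover have "card (S - {sb}) + 1 = card S" using s(3) finS by (metis Suc_eq_plus1 card_Suc_Diff1)
      moreover have "card (m ` R) = card R" using inj card_image by blast
      ultimately show ?thesis using SR(1,4) insert.hyps sepm[of R]
        by (intro exI[of _ "S - {sb}"] exI[of _ "m ` R"]) auto
    qed
  qed
qed

section \<open>Faces bordered by few edges\<close>

definition no_four_cycle :: "'a set set \<Rightarrow> bool" where
  "no_four_cycle E \<longleftrightarrow> (\<forall>a b c d. distinct [a,b,c,d] \<longrightarrow>
     \<not> ({a,b} \<in> E \<and> {b,c} \<in> E \<and> {c,d} \<in> E \<and> {d,a} \<in> E))"

definition triangles :: "'a set set \<Rightarrow> 'a set set" where
  "triangles E = {T. card T = 3 \<and> (\<forall>x\<in>T. \<forall>y\<in>T. x \<noteq> y \<longrightarrow> {x,y} \<in> E)}"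

text \<open>
Pendant edges \<open>ab\<close> with a new end \<open>b\<close> separate no points of the plane, so for faces only the core \<open>C\<close> matters.
\<close>

inductive peels :: "'a set set \<Rightarrow> 'a set set \<Rightarrow> bool" for C where
  core: "peels C C"
| leaf: "peels C B \<Longrightarrow> a \<noteq> b \<Longrightarrow> b \<notin> \<Union>B \<Longrightarrow> peels C (insert {a,b} B)"

lemma peels_mono: "peels C B \<Longrightarrow> C \<subseteq> B"
  by (induction rule: peels.induct) auto

text \<open>
Minimum degree two forces a cycle, which has to be a triangle. A further edge would need an end outside
this triangle and therefore a second further edge at that end, making five edges.
\<close>

lemma min_degree_two_small:
  assumes "finite B" "B \<noteq> {}" "card B \<le> 4" "no_four_cycle B"
    and two: "\<And>e. e \<in> B \<Longrightarrow> \<exists>a b. e = {a,b} \<and> a \<noteq> b"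
    and deg: "\<And>a b. {a,b} \<in> B \<Longrightarrow> a \<noteq> b \<Longrightarrow> \<exists>c. c \<noteq> a \<and> c \<noteq> b \<and> {b,c} \<in> B"
  shows "\<exists>a b c. distinct [a,b,c] \<and> B = {{a,b},{b,c},{c,a}}"
proof -
  obtain e where "e \<in> B" using assms(2) by blast
  then obtain a b where ab: "{a,b} \<in> B" "a \<noteq> b" using two[of e] by auto
  (* The path c, b, a, d either closes up to a triangle or forces a four-cycle or a fifth edge. *)
  obtain c where c: "c \<noteq> a" "c \<noteq> b" "{b,c} \<in> B" using deg[OF ab] by blast
  obtain d where d: "d \<noteq> a" "d \<noteq> b" "{a,d} \<in> B" using deg[of b a] ab by (auto simp: insert_commute)
  have over: False if "distinct es" "set es \<subseteq> B" "length es = 5" for es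
    using card_mono[OF assms(1) that(2)] distinct_card[OF that(1)] that(3) assms(3) by simp
  show ?thesis
  proof (cases "c = d")
    case True
    have "B = {{a,b},{b,c},{c,a}}"
    proof (rule ccontr)
      assume "B \<noteq> {{a,b},{b,c},{c,a}}"
      then obtain e where e: "e \<in> B" "e \<noteq> {a,b}" "e \<noteq> {b,c}" "e \<noteq> {c,a}"
        using ab c d True by (auto simp: insert_commute)
      obtain x y where "e = {x,y}" "x \<noteq> y" using two e(1) by blast
      then obtain x y where xy: "e = {x,y}" "x \<noteq> y" "y \<notin> {a,b,c}"
        using e by (metis insert_iff insert_commute empty_iff)
      obtain z where z: "z \<noteq> x" "z \<noteq> y" "{y,z} \<in> B" using deg[of x y] e(1) xy by blast
      have "distinct [{a,b},{b,c},{c,a},{x,y},{y,z}]"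
        using ab(2) c(1,2) xy(2,3) z(1,2) by (auto simp add: doubleton_eq_iff)
      moreover have "{c,a} \<in> B" using d(3) True by (simp add: insert_commute)
      ultimately show False
        using over[of "[{a,b},{b,c},{c,a},{x,y},{y,z}]"] ab(1) c(3) e(1) xy(1) z(3) by simp
    qed
    then show ?thesis using ab c by auto
  next
    case False
    obtain x where x: "x \<noteq> b" "x \<noteq> c" "{c,x} \<in> B" using deg[of b c] c by (auto simp: insert_commute)
    obtain y where y: "y \<noteq> a" "y \<noteq> d" "{d,y} \<in> B" using deg[of a d] d by (auto simp: insert_commute)
    have "x \<noteq> d" 
    proof
      assume "x = d"
      then have "{c,d} \<in> B" "{d,a} \<in> B" using x(3) d(3) by (simp_all add: insert_commute)
      moreover have "distinct [a,b,c,d]" using ab(2) c(1,2) d(1,2) False by auto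
      ultimately show False using assms(4) ab(1) c(3) unfolding no_four_cycle_def by blast
    qed
    have "{c,x} \<noteq> {d,y}" using False \<open>x \<noteq> d\<close> by (auto simp: doubleton_eq_iff)
    then have "distinct [{a,b},{b,c},{a,d},{c,x},{d,y}]"
      using \<open>x \<noteq> d\<close> False ab(2) c(1,2) d(1,2) x(1,2) y(1,2) by (auto simp add: doubleton_eq_iff)
    then show ?thesis
      using over[of "[{a,b},{b,c},{a,d},{c,x},{d,y}]"] ab(1) c(3) d(3) x(3) y(3) by simp
  qed
qed

lemma small_peels:
  assumes "finite B" "card B \<le> 4" "no_four_cycle B"
    and two: "\<And>e. e \<in> B \<Longrightarrow> \<exists>a b. e = {a,b} \<and> a \<noteq> b"
  shows "peels {} B \<or> (\<exists>a b c. distinct [a,b,c] \<and> peels {{a,b},{b,c},{c,a}} B)"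
  using assms
proof (induction "card B" arbitrary: B)
  case 0 then show ?case using peels.core by auto
next
  case (Suc n)
  show ?case
  proof (cases "\<exists>a b. {a,b} \<in> B \<and> a \<noteq> b \<and> b \<notin> \<Union>(B - {{a,b}})")
    case True
    then obtain a b where ab: "{a,b} \<in> B" "a \<noteq> b" "b \<notin> \<Union>(B - {{a,b}})" by blast
    have "card (B - {{a,b}}) = n" using Suc ab by simp
    moreover have "no_four_cycle (B - {{a,b}})" using Suc.prems(3) unfolding no_four_cycle_def by blast
    ultimately have "peels {} (B - {{a,b}}) \<or> (\<exists>x y z. distinct [x,y,z] \<and> peels {{x,y},{y,z},{z,x}} (B - {{a,b}}))"
      using Suc by (intro Suc.hyps(1)) auto
    moreover have "insert {a,b} (B - {{a,b}}) = B" using ab by auto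
    ultimately show ?thesis using peels.leaf[OF _ ab(2,3)] by metis
  next
    case False
    have "\<exists>a b c. distinct [a,b,c] \<and> B = {{a,b},{b,c},{c,a}}"
    proof (rule min_degree_two_small)
      show "B \<noteq> {}" using Suc.hyps(2) by auto
      fix a b assume ab: "{a,b} \<in> B" "a \<noteq> b"
      then obtain e where e: "e \<in> B" "e \<noteq> {a,b}" "b \<in> e" using False by blast
      then show "\<exists>c. c \<noteq> a \<and> c \<noteq> b \<and> {b,c} \<in> B" using Suc.prems(4)[OF e(1)]
        by (metis doubleton_eq_iff empty_iff insert_iff)
    qed (use Suc in auto)
    then show ?thesis using peels.core by metis
  qed
qed

lemma small_connected: "S \<subseteq> {x} \<Longrightarrow> connected S"
  by (metis connected_empty connected_sing subset_singleton_iff)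

context drawn begin

text \<open>
An edge belongs to the border of a face as soon as some inner point of it is in the closure; for an edge
on a Jordan curve of the drawing, \<open>face_along_arc\<close> shows that then all of its points are.
\<close>

definition boundary :: "complex set \<Rightarrow> 'a set set" where
  "boundary f = {e \<in> E. open_edge e \<inter> closure f \<noteq> {}}"

lemma face_props:
  assumes "f \<in> components (- drawing)"
  shows "open f" "connected f" "f \<subseteq> - drawing" "f \<noteq> {}" "frontier f \<subseteq> drawing"
proof -
  show "open f" using open_components[OF open_Compl[OF drawing_closed] assms] .
  show "connected f" using in_components_connected[OF assms] .
  show "f \<subseteq> - drawing" using in_components_subset[OF assms] .
  show "f \<noteq> {}" using in_components_nonempty[OF assms] .
  show "frontier f \<subseteq> drawing"
    using frontier_of_components_closed_complement[OF drawing_closed assms] by auto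
qed

lemma face_side:
  assumes f: "f \<in> components (- drawing)" and "J \<subseteq> drawing" "closed J"
  shows "f \<subseteq> inside J \<or> f \<subseteq> outside J"
proof -
  have "f \<subseteq> inside J \<union> outside J" using face_props(3)[OF f] assms(2) by auto
  moreover have "inside J \<inter> outside J \<inter> f = {}" by (simp add: inside_Int_outside)
  ultimately have "inside J \<inter> f = {} \<or> outside J \<inter> f = {}"
    using connectedD[OF face_props(2)[OF f]] open_inside[OF assms(3)] open_outside[OF assms(3)] by blast
  then show ?thesis using \<open>f \<subseteq> inside J \<union> outside J\<close> by blast
qed

text \<open>
The edge lies on a Jordan curve, and each side of this curve admits only one face along the edge.
\<close>

lemma two_faces_per_edge:
  assumes ab: "{a,b} \<in> E" "(a,b) \<in> (adj (E - {{a,b}}))\<^sup>*"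
    and F: "finite F" "F \<subseteq> components (- drawing)"
  shows "card {f \<in> F. {a,b} \<in> boundary f} \<le> 2"
proof -
  let ?e = "{a,b}"
  obtain g h where gh: "arc g" "arc h" "pathstart h = pathfinish g" "pathfinish h = pathstart g"
    "path_image g \<inter> path_image h \<subseteq> {pathstart g, pathfinish g}" "path_image g = img ?e"
    "path_image h \<subseteq> \<Union>(img ` (E - {?e}))" "open_edge ?e = path_image g - {pathstart g, pathfinish g}"
    using edge_on_loop[OF ab] by metis
  define J where "J = path_image g \<union> path_image h"
  note J = loop_of_arcs[OF gh(1-5), folded J_def]
  have JD: "J \<subseteq> drawing" unfolding J_def drawing_def using gh(6,7) ab(1) by auto
  have one: "f1 = f2" if K: "connected K" "K \<subseteq> - J" "frontier K = J" 
    and f: "f1 \<in> F" "f2 \<in> F" "f1 \<subseteq> K" "f2 \<subseteq> K" "?e \<in> boundary f1" "?e \<in> boundary f2" for K f1 f2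
  proof -
    have fc: "f1 \<in> components (- drawing)" "f2 \<in> components (- drawing)" using f F by auto
    obtain p where p: "p \<in> open_edge ?e" "p \<in> closure f1" using f(5) unfolding boundary_def by auto
    obtain q where q: "q \<in> open_edge ?e" "q \<in> closure f2" using f(6) unfolding boundary_def by auto
    note cl = open_edge_closed_Diff[OF ab(1), unfolded gh(8)]
    note pq = p[unfolded gh(8)] q[unfolded gh(8)]
    have "p \<in> closure f2"
      using face_along_arc(1)[OF gh(1-5) JD[unfolded J_def] cl K[unfolded J_def] fc(2) f(4) pq(3,4)] pq(1) by blast
    then obtain d1 d2 where d: "d1 > 0" "d2 > 0" "K \<inter> ball p d1 \<subseteq> f1" "K \<inter> ball p d2 \<subseteq> f2"
      using face_along_arc(2)[OF gh(1-5) JD[unfolded J_def] cl K[unfolded J_def] fc(1) f(3) pq(1,2)]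
        face_along_arc(2)[OF gh(1-5) JD[unfolded J_def] cl K[unfolded J_def] fc(2) f(4) pq(1)] by blast
    have "p \<in> closure K" using K(3) pq(1) unfolding J_def frontier_def by blast
    then obtain x where "x \<in> K" "dist x p < min d1 d2" using d(1,2) by (metis closure_approachable min_less_iff_conj)
    then have "x \<in> f1" "x \<in> f2" using d(3,4) by (auto simp: dist_commute)
    then show "f1 = f2" using fc components_eq by blast
  qed
  let ?X = "{f \<in> F. ?e \<in> boundary f}"
  define I where "I = {f \<in> ?X. f \<subseteq> inside J}"
  define O' where "O' = {f \<in> ?X. f \<subseteq> outside J}"
  have fin: "finite I" "finite O'" unfolding I_def O'_def using F(1) by auto
  have sides: "inside J \<subseteq> - J" "outside J \<subseteq> - J" using J(9) by blast+
  have "card I \<le> Suc 0"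
    unfolding card_le_Suc0_iff_eq[OF fin(1)] unfolding I_def using one[OF J(3) sides(1) J(10)] by blast
  moreover have "card O' \<le> Suc 0"
    unfolding card_le_Suc0_iff_eq[OF fin(2)] unfolding O'_def using one[OF J(5) sides(2) J(11)] by blast
  moreover have "?X = I \<union> O'" unfolding I_def O'_def
    using face_side[OF _ JD] F(2) J(1) compact_imp_closed by blast
  ultimately show ?thesis using card_Un_le[of I O'] by simp
qed

text \<open>
The frontier of a face is drawn by vertices and bordering edges alone, so the face remains a
component when the rest of the drawing is erased.
\<close>

lemma face_absorbs:
  assumes f: "f \<in> components (- drawing)" "u \<in> f"
    and v: "connected_component (- (\<Union>(img ` boundary f) \<union> pos ` V)) u v"
  shows "v \<in> f"
proof (rule ccontr)
  assume "v \<notin> f"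
  obtain T where T: "connected T" "T \<subseteq> - (\<Union>(img ` boundary f) \<union> pos ` V)" "u \<in> T" "v \<in> T"
    using v unfolding connected_component_def by blast
  then obtain p where p: "p \<in> T" "p \<in> frontier f"
    using connected_Int_frontier[OF T(1), of f] f(2) \<open>v \<notin> f\<close> by blast
  then have "p \<in> drawing" using face_props(5)[OF f(1)] by blast
  then obtain e where e: "e \<in> E" "p \<in> img e" using p(1) T(2) unfolding drawing_def by blast
  have "p \<notin> pos ` e" using p(1) T(2) edge_subset[OF e(1)] by blast
  then have "e \<in> boundary f" using e p(2) unfolding boundary_def open_edge_def frontier_def by blast
  then show False using p(1) T(2) e by blast
qed

text \<open>
A pendant edge meets the rest in at most one point and does not separate the plane itself, so by
Janiszewski's theorem attaching it separates no two points.
\<close>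

lemma peels_connect:
  assumes "peels C B" "B \<subseteq> E" "connected_component (- \<Union>(img ` C)) u v"
    "u \<notin> \<Union>(img ` B)" "v \<notin> \<Union>(img ` B)"
  shows "connected_component (- \<Union>(img ` B)) u v"
  using assms
proof (induction rule: peels.induct)
  case core then show ?case by simp
next
  case (leaf B a b)
  show ?case
  proof (cases "{a,b} \<in> B")
    case True then show ?thesis using leaf by (simp add: insert_absorb)
  next
    case False
    have e: "{a,b} \<in> E" "B \<subseteq> E" using leaf by auto
    have fB: "finite B" using e(2) finE finite_subset by blast
    have 1: "compact (\<Union>(img ` B))" using fB e(2) img_compact by (intro compact_UN) auto
    have 2: "closed (img {a,b})" using e(1) img_compact compact_imp_closed by blast
    have "img e' \<inter> img {a,b} \<subseteq> {pos a}" if "e' \<in> B" for e'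
    proof -
      have "e' \<inter> {a,b} \<subseteq> {a}" using leaf.hyps that by auto
      then show ?thesis using img_disjoint[of e' "{a,b}"] that e False by blast
    qed
    then have 3: "connected (\<Union>(img ` B) \<inter> img {a,b})" by (intro small_connected[of _ "pos a"]) blast
    have 4: "connected_component (- img {a,b}) u v"
      unfolding connected_component_def using img_complement_connected[OF e(1)] leaf.prems by blast
    have "connected_component (- (\<Union>(img ` B) \<union> img {a,b})) u v"
      by (rule Janiszewski[OF 1 2 3 _ 4]) (use leaf in auto)
    then show ?thesis by (simp add: Un_commute)
  qed
qed

lemma points_connect:
  fixes S :: "complex set"
  assumes "finite W" "compact S" "connected_component (- S) u v" "u \<notin> W" "v \<notin> W"
  shows "connected_component (- (S \<union> W)) u v"
  using assms
proof (induction W)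
  case (insert w W)
  have IH: "connected_component (- (S \<union> W)) u v" using insert by auto
  have c: "compact (S \<union> W)" using insert by (auto intro: compact_Un finite_imp_compact)
  have "connected (- {w})" by (rule connected_punctured_universe) simp
  then have "connected_component (- {w}) u v" unfolding connected_component_def using insert.prems by blast
  then have "connected_component (- ((S \<union> W) \<union> {w})) u v"
    using Janiszewski[OF c _ small_connected[of "(S \<union> W) \<inter> {w}" w] IH] by auto
  then show ?case by simp
qed simp

text \<open>
For a triangle \<open>T\<close> this is the Jordan curve formed by its three edges.
\<close>

definition rim :: "'a set \<Rightarrow> complex set" where
  "rim T = \<Union>(img ` {e \<in> E. e \<subseteq> T})"

lemma rim_loop:
  assumes "distinct [a,b,c]" "{a,b} \<in> E" "{b,c} \<in> E" "{c,a} \<in> E"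
  shows "{e \<in> E. e \<subseteq> {a,b,c}} = {{a,b},{b,c},{c,a}}" "compact (rim {a,b,c})"
    "connected (inside (rim {a,b,c}))" "connected (outside (rim {a,b,c}))"
proof -
  show edges: "{e \<in> E. e \<subseteq> {a,b,c}} = {{a,b},{b,c},{c,a}}"
  proof (intro equalityI subsetI)
    fix e assume e: "e \<in> {e \<in> E. e \<subseteq> {a,b,c}}"
    then have "e \<in> E" by simp
    from edge[OF this] obtain x y where xy: "e = {x,y}" "x \<noteq> y" by blast
    then have "x \<in> {a,b,c}" "y \<in> {a,b,c}" using e by auto
    then show "e \<in> {{a,b},{b,c},{c,a}}" unfolding xy(1) using xy(2)
      by (simp add: doubleton_eq_iff) blast
  next
    fix e assume "e \<in> {{a,b},{b,c},{c,a}}"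
    then show "e \<in> {e \<in> E. e \<subseteq> {a,b,c}}" using assms(2-4) by fast
  qed
  obtain g where g: "arc g" "pathstart g = pos a" "pathfinish g = pos b" "path_image g = img {a,b}"
    using arc[OF assms(2)] by blast
  obtain h where h: "arc h" "pathstart h = pos b" "pathfinish h = pos c" "path_image h = img {b,c}"
    using arc[OF assms(3)] by blast
  obtain k where k: "arc k" "pathstart k = pos c" "pathfinish k = pos a" "path_image k = img {c,a}"
    using arc[OF assms(4)] by blast
  have d: "{a,b} \<inter> {b,c} = {b}" "{b,c} \<inter> {c,a} = {c}" "{a,b} \<inter> {c,a} = {a}"
    "{a,b} \<noteq> {b,c}" "{b,c} \<noteq> {c,a}" "{a,b} \<noteq> {c,a}"
    using assms(1) by (auto simp: doubleton_eq_iff)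
  have i: "img {a,b} \<inter> img {b,c} \<subseteq> {pos b}" "img {b,c} \<inter> img {c,a} \<subseteq> {pos c}" "img {a,b} \<inter> img {c,a} \<subseteq> {pos a}"
    using img_disjoint[OF assms(2,3) d(4)] img_disjoint[OF assms(3,4) d(5)] img_disjoint[OF assms(2,4) d(6)]
    unfolding d by auto
  have hk: "arc (h +++ k)" using h k i(2) by (intro arc_join) auto
  have im: "path_image (h +++ k) = img {b,c} \<union> img {c,a}" using h k by (simp add: path_image_join)
  have rim: "rim {a,b,c} = path_image g \<union> path_image (h +++ k)"
    unfolding rim_def edges im g(4) by auto
  note L = loop_of_arcs[OF g(1) hk]
  show "compact (rim {a,b,c})" "connected (inside (rim {a,b,c}))" "connected (outside (rim {a,b,c}))"
    unfolding rim by (rule L; use g h k i im in auto)+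
qed

text \<open>
The border of the face peels down to nothing or to a triangle. In the first case it does not separate the
plane, so the face is everything outside it; then all edges are on the border and the graph
has a pendant or isolated vertex, contrary to the cut condition. In the second case the face contains every
point of its side of the triangle that is not on the drawing.
\<close>

lemma small_face:
  assumes f: "f \<in> components (- drawing)" and c4: "no_four_cycle E" and small: "card (boundary f) \<le> 4"
    and cut: "\<And>A. A \<noteq> {} \<Longrightarrow> A \<subset> V \<Longrightarrow> 2 \<le> card {e \<in> E. e \<inter> A \<noteq> {} \<and> \<not> e \<subseteq> A}"
    and V: "2 \<le> card V"
  shows "\<exists>T\<in>triangles E. 3 \<le> card (boundary f) \<and>
     (f \<subseteq> inside (rim T) \<and> inside (rim T) - drawing \<subseteq> f \<or> f \<subseteq> outside (rim T) \<and> outside (rim T) - drawing \<subseteq> f)"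
proof -
  define B where "B = boundary f"
  have BE: "B \<subseteq> E" unfolding B_def boundary_def by blast
  have fB: "finite B" using BE finE finite_subset by blast
  have cB: "compact (\<Union>(img ` B))" using fB BE img_compact by (intro compact_UN) auto
  have BD: "\<Union>(img ` B) \<union> pos ` V \<subseteq> drawing" unfolding drawing_def using BE by auto
  have "no_four_cycle B" using c4 BE unfolding no_four_cycle_def by blast
  moreover have "card B \<le> 4" using small unfolding B_def .
  moreover have "\<And>e. e \<in> B \<Longrightarrow> \<exists>a b. e = {a,b} \<and> a \<noteq> b" using edge BE by (metis subsetD)
  ultimately have peel: "peels {} B \<or> (\<exists>a b c. distinct [a,b,c] \<and> peels {{a,b},{b,c},{c,a}} B)"
    using small_peels[OF fB] by metis
  have absorb: "v \<in> f" if "peels C B" "u \<in> f" "v \<notin> \<Union>(img ` B) \<union> pos ` V" "connected_component (- \<Union>(img ` C)) u v" for C u v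
  proof -
    have "u \<notin> drawing" using face_props(3)[OF f] that(2) by blast
    then have u: "u \<notin> \<Union>(img ` B) \<union> pos ` V" using BD by blast
    have "connected_component (- \<Union>(img ` B)) u v"
      using peels_connect[OF that(1) BE that(4)] u that(3) by blast
    then have "connected_component (- (\<Union>(img ` B) \<union> pos ` V)) u v"
      using points_connect[of "pos ` V", OF _ cB] fin u that(3) by blast
    then show ?thesis using face_absorbs[OF f that(2)] unfolding B_def by blast
  qed
  show ?thesis
  proof (cases "peels {} B")
    case True
    obtain u where u: "u \<in> f" using face_props(4)[OF f] by blast
    have "connected_component UNIV u v" for v
      unfolding connected_component_def using connected_UNIV by blast
    then have all: "v \<in> f" if "v \<notin> \<Union>(img ` B) \<union> pos ` V" for v
      using absorb[OF True u that] by simp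
    have "E \<subseteq> B"
    proof
      fix e assume e: "e \<in> E"
      obtain p where p: "p \<in> open_edge e" using open_edge_nonempty_connected(1)[OF e] by blast
      then have "p \<in> drawing" using e unfolding drawing_def open_edge_def by blast
      then have "p \<notin> f" using face_props(3)[OF f] by blast
      then have "p \<in> \<Union>(img ` B)" using all open_edge_not_vertex[OF e p] by blast
      then show "e \<in> B" using open_edge_in_other[OF e p] BE by blast
    qed
    then have EB: "E = B" using BE by blast
    have "peels {} E" using True EB by simp
    then show ?thesis
    proof cases
      case core
      obtain a where "a \<in> V" using V by fastforce
      moreover have "{a} \<noteq> V" using V by auto
      ultimately show ?thesis using cut[of "{a}"] core by auto
    next
      case (leaf B' a b)
      have "{a,b} \<in> E" using leaf by simp
      then have "a \<in> V" "b \<in> V" using edge_subset by auto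
      then have "2 \<le> card {e \<in> E. e \<inter> {b} \<noteq> {} \<and> \<not> e \<subseteq> {b}}" using cut[of "{b}"] leaf(3) by blast
      also have "{e \<in> E. e \<inter> {b} \<noteq> {} \<and> \<not> e \<subseteq> {b}} \<subseteq> {{a,b}}" using leaf by auto
      then have "card {e \<in> E. e \<inter> {b} \<noteq> {} \<and> \<not> e \<subseteq> {b}} \<le> card {{a,b}}" by (intro card_mono) auto
      finally show ?thesis by simp
    qed
  next
    case False
    then obtain a b c where abc: "distinct [a,b,c]" "peels {{a,b},{b,c},{c,a}} B" using peel by blast
    have sub: "{{a,b},{b,c},{c,a}} \<subseteq> B" using peels_mono[OF abc(2)] .
    then have e: "{a,b} \<in> E" "{b,c} \<in> E" "{c,a} \<in> E" using BE by auto
    let ?T = "{a,b,c}"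
    note rim = rim_loop[OF abc(1) e]
    have rimC: "rim ?T = \<Union>(img ` {{a,b},{b,c},{c,a}})" unfolding rim_def rim(1) ..
    have T: "?T \<in> triangles E" using abc(1) e unfolding triangles_def by (auto simp: insert_commute)
    have "card {{a,b},{b,c},{c,a}} = 3" using abc(1) by (auto simp: card_insert_if doubleton_eq_iff)
    then have three: "3 \<le> card (boundary f)" using card_mono[OF fB sub] unfolding B_def by simp
    have rD: "rim ?T \<subseteq> drawing" unfolding rim_def drawing_def by blast
    have clos: "K - drawing \<subseteq> f" if "f \<subseteq> K" "connected K" "K \<subseteq> - rim ?T" for K
    proof
      fix v assume v: "v \<in> K - drawing"
      obtain u where u: "u \<in> f" using face_props(4)[OF f] by blast
      have "connected_component (- rim ?T) u v" unfolding connected_component_def using that u v by blast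
      then show "v \<in> f" using absorb[OF abc(2) u] v BD unfolding rimC by blast
    qed
    have "inside (rim ?T) \<subseteq> - rim ?T" "outside (rim ?T) \<subseteq> - rim ?T"
      using inside_no_overlap outside_no_overlap by blast+
    then have "f \<subseteq> inside (rim ?T) \<and> inside (rim ?T) - drawing \<subseteq> f \<or> f \<subseteq> outside (rim ?T) \<and> outside (rim ?T) - drawing \<subseteq> f"
      using face_side[OF f rD compact_imp_closed[OF rim(2)]] clos rim(3,4) by blast
    then show ?thesis using T three by blast
  qed
qed

end

section \<open>Sparsity of plane graphs without four-cycles\<close>

lemma tri_subset_Union: assumes "T \<in> triangles E" shows "T \<subseteq> \<Union>E"
proof
  fix x assume x: "x \<in> T"
  have "card T = 3" using assms unfolding triangles_def by simp
  then have "T \<noteq> {x}" by auto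
  then obtain y where "y \<in> T" "x \<noteq> y" using x by blast
  then have "{x,y} \<in> E" using assms x unfolding triangles_def by simp
  then show "x \<in> \<Union>E" by blast
qed

lemma tri_nonempty: "T \<in> triangles E \<Longrightarrow> T \<noteq> {}"
  unfolding triangles_def by auto

lemma tri_mono: "E' \<subseteq> E \<Longrightarrow> triangles E' \<subseteq> triangles E"
  unfolding triangles_def by blast

lemma no_four_cycle_mono: "no_four_cycle E \<Longrightarrow> E' \<subseteq> E \<Longrightarrow> no_four_cycle E'"
  unfolding no_four_cycle_def by blast

lemma tri_induced: "triangles {e\<in>E. e \<subseteq> Y} = {T\<in>triangles E. T \<subseteq> Y}"
proof (intro equalityI subsetI)
  fix T assume "T \<in> triangles {e\<in>E. e \<subseteq> Y}"
  moreover from this have "T \<subseteq> Y" using tri_subset_Union by fastforce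
  ultimately show "T \<in> {T\<in>triangles E. T \<subseteq> Y}" using tri_mono[of "{e\<in>E. e \<subseteq> Y}" E] by auto
next
  fix T assume "T \<in> {T\<in>triangles E. T \<subseteq> Y}"
  then show "T \<in> triangles {e\<in>E. e \<subseteq> Y}" unfolding triangles_def by auto
qed

lemma double_count:
  assumes "finite A" "finite B"
  shows "(\<Sum>x\<in>A. card {y\<in>B. P x y}) = (\<Sum>y\<in>B. card {x\<in>A. P x y})"
proof -
  have "(\<Sum>x\<in>A. card {y\<in>B. P x y}) = (\<Sum>x\<in>A. \<Sum>y\<in>B. if P x y then 1 else 0)"
    using assms by (simp add: sum.If_cases Int_def)
  also have "\<dots> = (\<Sum>y\<in>B. \<Sum>x\<in>A. if P x y then 1 else 0)" by (rule sum.swap)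
  also have "\<dots> = (\<Sum>y\<in>B. card {x\<in>A. P x y})"
    using assms by (simp add: sum.If_cases Int_def)
  finally show ?thesis .
qed

context drawn begin

lemma finite_tri: "finite (triangles E)"
proof -
  have "triangles E \<subseteq> Pow V" using tri_subset_Union edge_subset by blast
  then show ?thesis using fin finite_subset by blast
qed

text \<open>
Two such faces inside the same triangle contain each other, and any two outside their triangles contain a
common far-away point. So labelling a face by its triangle if it is inside one, and by \<open>None\<close>
otherwise, is injective.
\<close>

lemma few_small_faces:
  assumes F: "finite F" "F \<subseteq> components (- drawing)" and c4: "no_four_cycle E" 
    and cut: "\<And>A. A \<noteq> {} \<Longrightarrow> A \<subset> V \<Longrightarrow> 2 \<le> card {e \<in> E. e \<inter> A \<noteq> {} \<and> \<not> e \<subseteq> A}"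
    and V: "2 \<le> card V"
  shows "card {f \<in> F. card (boundary f) \<le> 4} \<le> card (triangles E) + 1"
proof -
  define S where "S = {f \<in> F. card (boundary f) \<le> 4}"
  define win where "win f T \<longleftrightarrow> f \<subseteq> inside (rim T) \<and> inside (rim T) - drawing \<subseteq> f" for f T
  define wout where "wout f T \<longleftrightarrow> f \<subseteq> outside (rim T) \<and> outside (rim T) - drawing \<subseteq> f" for f T
  have comp: "f \<in> components (- drawing)" if "f \<in> S" for f using that F(2) unfolding S_def by blast
  have ex: "\<exists>T\<in>triangles E. win f T \<or> wout f T" if "f \<in> S" for f
    using small_face[OF comp[OF that] c4 _ cut V] that unfolding S_def win_def wout_def by blast
  define lab where "lab f = (if \<exists>T\<in>triangles E. win f T then Some (SOME T. T \<in> triangles E \<and> win f T) else None)" for f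
  have some: "(SOME T. T \<in> triangles E \<and> win f T) \<in> triangles E \<and> win f (SOME T. T \<in> triangles E \<and> win f T)"
    if "\<exists>T\<in>triangles E. win f T" for f
    by (rule someI_ex) (use that in blast)
  have eq: "f = f'" if "f \<in> S" "f' \<in> S" "f \<inter> f' \<noteq> {}" for f f'
    using components_eq[OF comp comp] that by blast
  obtain r where r: "drawing \<subseteq> ball 0 r" using drawing_compact compact_imp_bounded bounded_subset_ballD by blast
  (* A point outside a disc around the whole drawing, hence outside every triangle. *)
  define q where "q = complex_of_real r"
  have q: "q \<notin> ball 0 r" unfolding q_def by simp
  have far: "q \<in> outside (rim T) - drawing" for T
  proof -
    have "rim T \<subseteq> ball 0 r" using r unfolding rim_def drawing_def by blast
    then show ?thesis using q r outside_subset_convex[of "ball 0 r" "rim T"] by auto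
  qed
  have "inj_on lab S"
  proof (rule inj_onI)
    fix f f' assume ff: "f \<in> S" "f' \<in> S" "lab f = lab f'"
    show "f = f'"
    proof (cases "lab f")
      case None
      then have "\<exists>T\<in>triangles E. wout f T" "\<exists>T\<in>triangles E. wout f' T"
        using ex[OF ff(1)] ex[OF ff(2)] ff(3) unfolding lab_def by (auto split: if_splits)
      then have "q \<in> f" "q \<in> f'" using far unfolding wout_def by blast+
      then show ?thesis using eq ff by blast
    next
      case (Some T)
      then have "win f T" "win f' T" using some[of f] some[of f'] ff(3) unfolding lab_def
        by (auto split: if_splits)
      moreover have "f \<subseteq> - drawing" "f \<noteq> {}" using face_props(3,4)[OF comp[OF ff(1)]] .
      ultimately have "f \<inter> f' \<noteq> {}" unfolding win_def by blast
      then show ?thesis using eq ff by blast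
    qed
  qed
  moreover have "lab ` S \<subseteq> insert None (Some ` triangles E)"
    using some unfolding lab_def by auto
  then have "card (lab ` S) \<le> card (insert None (Some ` triangles E))"
    using finite_tri by (intro card_mono) auto
  moreover have "card (insert None (Some ` triangles E)) = card (triangles E) + 1"
    using finite_tri by (simp add: card_image card_insert_disjoint image_iff)
  ultimately show ?thesis unfolding S_def by (simp add: card_image)
qed

text \<open>
Under the cut condition every edge lies on a cycle, so it borders at most two faces, and the count of
pairs of a face and a bordering edge goes through.
\<close>

lemma bridgeless_sparse:
  assumes c4: "no_four_cycle E" 
    and cut: "\<And>A. A \<noteq> {} \<Longrightarrow> A \<subset> V \<Longrightarrow> 2 \<le> card {e \<in> E. e \<inter> A \<noteq> {} \<and> \<not> e \<subseteq> A}"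
    and V: "2 \<le> card V"
  shows "3 * card E + 5 \<le> 5 * card V + 2 * card (triangles E)"
proof -
  obtain S R where SR: "S \<subseteq> V" "\<forall>v\<in>V. \<exists>s\<in>S. (v,s) \<in> (adj E)\<^sup>*" "in_distinct_faces R"
      "card E + card S + 1 \<le> card R + card V"
    using many_faces[OF drawn_axioms] by blast
  have finS: "finite S" using SR(1) fin finite_subset by blast
  have "S \<noteq> {}" using SR(2) V by fastforce
  then have S1: "card S \<ge> 1" using finS by (simp add: Suc_leI card_gt_0_iff)
  define C where "C = (\<lambda>r. connected_component_set (- drawing) r)"
  define F where "F = C ` R"
  have finF: "finite F" using SR(3) unfolding F_def in_distinct_faces_def by simp
  have FC: "F \<subseteq> components (- drawing)" using SR(3) unfolding F_def C_def in_distinct_faces_def components_def by blast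
  have "inj_on C R"
  proof (rule inj_onI, rule ccontr)
    fix x y assume xy: "x \<in> R" "y \<in> R" "C x = C y" "x \<noteq> y"
    have "y \<in> C y" using xy SR(3) unfolding C_def in_distinct_faces_def by auto
    then have "y \<in> C x" using xy(3) by simp
    then have "connected_component (- drawing) x y" unfolding C_def by (simp only: mem_Collect_eq)
    then show False using xy SR(3) unfolding in_distinct_faces_def by blast
  qed
  then have cF: "card F = card R" unfolding F_def by (rule card_image)
  have "card {f \<in> F. e \<in> boundary f} \<le> 2" if e: "e \<in> E" for e
  proof -
    obtain a b where ab: "e = {a,b}" "a \<noteq> b" "a \<in> V" "b \<in> V" using edge[OF e] by metis
    define A where "A = {x\<in>V. (a,x) \<in> (adj (E - {{a,b}}))\<^sup>*}"
    have "(a,b) \<in> (adj (E - {{a,b}}))\<^sup>*"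
    proof (rule ccontr)
      assume no: "(a,b) \<notin> (adj (E - {{a,b}}))\<^sup>*"
      have "a \<in> A" "b \<notin> A" using ab no unfolding A_def by auto
      then have "A \<noteq> {}" "A \<subset> V" using ab(4) unfolding A_def by auto
      then have "2 \<le> card {e \<in> E. e \<inter> A \<noteq> {} \<and> \<not> e \<subseteq> A}" by (rule cut)
      moreover have "{e \<in> E. e \<inter> A \<noteq> {} \<and> \<not> e \<subseteq> A} \<subseteq> {{a,b}}"
      proof (rule subsetI, rule ccontr)
        fix d assume d: "d \<in> {e \<in> E. e \<inter> A \<noteq> {} \<and> \<not> e \<subseteq> A}" "d \<notin> {{a,b}}"
        then obtain x where x: "x \<in> d" "x \<in> A" by blast
        from d obtain y where y: "y \<in> d" "y \<notin> A" by blast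
        have "d \<in> E" using d by simp
        from edge[OF this] obtain s t where "d = {s,t}" by blast
        then have "d = {x,y}" using x y by auto
        then have "(x,y) \<in> adj (E - {{a,b}})" using d unfolding adj_def by auto
        then have "(a,y) \<in> (adj (E - {{a,b}}))\<^sup>*" using x(2) unfolding A_def by (auto intro: rtrancl_into_rtrancl)
        moreover have "y \<in> V" using edge_subset[OF \<open>d \<in> E\<close>] y(1) by blast
        ultimately show False using y(2) unfolding A_def by blast
      qed
      then have "card {e \<in> E. e \<inter> A \<noteq> {} \<and> \<not> e \<subseteq> A} \<le> card {{a,b}}" by (intro card_mono) auto
      ultimately show False by simp
    qed
    then show ?thesis using two_faces_per_edge[OF _ _ finF FC, of a b] e unfolding ab(1) by blast
  qed
  then have up: "(\<Sum>e\<in>E. card {f \<in> F. e \<in> boundary f}) \<le> 2 * card E"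
    using sum_bounded_above[of E "\<lambda>e. card {f \<in> F. e \<in> boundary f}" 2] by simp
  have b: "{e \<in> E. e \<in> boundary f} = boundary f" for f unfolding boundary_def by blast
  have "(\<Sum>f\<in>F. card (boundary f)) \<le> 2 * card E"
    using up double_count[OF finF finE, of "\<lambda>f e. e \<in> boundary f"] unfolding b by simp
  moreover have "5 * card F \<le> (\<Sum>f\<in>F. card (boundary f)) + 2 * card {f \<in> F. card (boundary f) \<le> 4}"
  proof -
    have "5 * card F = (\<Sum>f\<in>F. 5)" by simp
    also have "\<dots> \<le> (\<Sum>f\<in>F. card (boundary f) + (if card (boundary f) \<le> 4 then 2 else 0))"
    proof (rule sum_mono)
      fix f assume f: "f \<in> F"
      then have fc: "f \<in> components (- drawing)" using FC by blast
      show "5 \<le> card (boundary f) + (if card (boundary f) \<le> 4 then 2 else 0)"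
      proof (cases "card (boundary f) \<le> 4")
        case True
        then have "3 \<le> card (boundary f)" using small_face[OF fc c4 True cut V] by blast
        then show ?thesis using True by simp
      qed simp
    qed
    also have "\<dots> = (\<Sum>f\<in>F. card (boundary f)) + 2 * card {f \<in> F. card (boundary f) \<le> 4}"
      using finF by (simp add: sum.distrib sum.If_cases Int_def)
    finally show ?thesis .
  qed
  ultimately show ?thesis using few_small_faces[OF finF FC c4 cut V] cF SR(4) S1 by linarith
qed

end

text \<open>
Across a cut with at most one edge, the constant \<open>5\<close> gained from each of the two parts makes up for
the three units that this edge costs.
\<close>

theorem drawn_sparse:
  assumes "drawn V E pos img" "no_four_cycle E" "V \<noteq> {}"
  shows "3 * card E + 5 \<le> 5 * card V + 2 * card (triangles E)"
  using assms
proof (induction "card V" arbitrary: V E rule: less_induct)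
  case less
  interpret drawn V E pos img by fact
  show ?case
  proof (cases "\<exists>A. A \<noteq> {} \<and> A \<subset> V \<and> card {e \<in> E. e \<inter> A \<noteq> {} \<and> \<not> e \<subseteq> A} < 2")
    case True
    then obtain A where A: "A \<noteq> {}" "A \<subset> V" "card {e \<in> E. e \<inter> A \<noteq> {} \<and> \<not> e \<subseteq> A} < 2" by blast
    define X where "X = {e \<in> E. e \<inter> A \<noteq> {} \<and> \<not> e \<subseteq> A}"
    define E1 where "E1 = {e \<in> E. e \<subseteq> A}"
    define E2 where "E2 = {e \<in> E. e \<subseteq> V - A}"
    have E: "E = E1 \<union> E2 \<union> X" using edge_subset unfolding E1_def E2_def X_def by blast
    have sub: "E1 \<subseteq> E" "E2 \<subseteq> E" "\<Union>E1 \<subseteq> A" "\<Union>E2 \<subseteq> V - A" unfolding E1_def E2_def by auto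
    have finA: "finite A" "finite E1" "finite E2" 
      using A(2) sub finE fin by (meson finite_subset psubset_imp_subset)+
    have c4: "no_four_cycle E1" "no_four_cycle E2" using less.prems(2) sub(1,2) unfolding no_four_cycle_def by blast+
    have cV: "card V = card A + card (V - A)" "card A < card V" "card (V - A) < card V"
    proof -
      have "A \<subseteq> V" using A(2) by blast
      then show "card V = card A + card (V - A)"
        using card_mono[OF fin] card_Diff_subset[OF finA(1)] by simp
      show "card A < card V" "card (V - A) < card V"
        using A(1,2) by (auto intro!: psubset_card_mono[OF fin])
    qed
    have 1: "3 * card E1 + 5 \<le> 5 * card A + 2 * card (triangles E1)"
      by (rule less.hyps[OF cV(2) drawn_subgraph[OF less.prems(1)] c4(1) A(1)]) (use A sub in auto)
    have 2: "3 * card E2 + 5 \<le> 5 * card (V - A) + 2 * card (triangles E2)"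
      by (rule less.hyps[OF cV(3) drawn_subgraph[OF less.prems(1)] c4(2)]) (use A sub in auto)
    have "triangles E1 \<inter> triangles E2 = {}"
    proof (rule equals0I)
      fix T assume T: "T \<in> triangles E1 \<inter> triangles E2"
      then have "T \<subseteq> \<Union>E1" "T \<subseteq> \<Union>E2" "T \<noteq> {}"
        using tri_subset_Union[of T] tri_nonempty[of T E1] by auto
      then show False using sub(3,4) by blast
    qed
    moreover have "triangles E1 \<union> triangles E2 \<subseteq> triangles E" using tri_mono sub by blast
    ultimately have "card (triangles E1) + card (triangles E2) \<le> card (triangles E)"
      using finite_tri by (metis card_Un_disjoint card_mono finite_Un finite_subset)
    moreover have "card E \<le> card E1 + card E2 + card X"
      unfolding E by (meson card_Un_le le_trans add_le_mono1)
    ultimately show ?thesis using 1 2 cV(1) A(3) unfolding X_def[symmetric] by linarith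
  next
    case False
    show ?thesis
    proof (cases "card V \<ge> 2")
      case True
      show ?thesis by (rule bridgeless_sparse[OF less.prems(2) _ True]) (use False in \<open>meson not_less\<close>)
    next
      case F: False
      then have "card V = 1" using less.prems(3) fin by (metis One_nat_def Suc_1 card_0_eq less_2_cases not_less)
      then obtain v where "V = {v}" using card_1_singletonE by blast
      have "E = {}"
      proof (rule ccontr)
        assume "E \<noteq> {}"
        then obtain e where "e \<in> E" by blast
        from edge[OF this] show False using \<open>V = {v}\<close> by blast
      qed
      then show ?thesis using \<open>card V = 1\<close> by simp
    qed
  qed
qed

definition sparse :: "'a set \<Rightarrow> 'a set set \<Rightarrow> bool" where
  "sparse V E \<longleftrightarrow> (\<forall>Y\<subseteq>V. Y \<noteq> {} \<longrightarrow>
     3 * card {e\<in>E. e \<subseteq> Y} + 5 \<le> 5 * card Y + 2 * card {T\<in>triangles E. T \<subseteq> Y})"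

corollary drawn_hereditarily_sparse:
  assumes "drawn V E pos img" "no_four_cycle E"
  shows "sparse V E"
  unfolding sparse_def
proof (intro allI impI)
  fix Y assume Y: "Y \<subseteq> V" "Y \<noteq> {}"
  let ?E = "{e\<in>E. e \<subseteq> Y}"
  have "drawn Y ?E pos img" by (rule drawn_subgraph[OF assms(1) Y(1)]) auto
  moreover have "no_four_cycle ?E" by (rule no_four_cycle_mono[OF assms(2)]) auto
  ultimately have "3 * card ?E + 5 \<le> 5 * card Y + 2 * card (triangles ?E)" using drawn_sparse Y(2) by blast
  then show "3 * card ?E + 5 \<le> 5 * card Y + 2 * card {T\<in>triangles E. T \<subseteq> Y}" by (simp only: tri_induced)
qed

section \<open>Sharing constraints among vertices\<close>

text \<open>
Hall's marriage theorem in which each \<open>u\<close> requires \<open>d u\<close> partners. A partner \<open>i\<close> of \<open>u\<close> can be assigned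
unless a tight set avoiding \<open>u\<close> needs \<open>i\<close>. If every \<open>i\<close> were blocked in this way, the union of
the tight sets would be tight by submodularity and would claim all partners of \<open>u\<close>, leaving none for \<open>u\<close>.
\<close>

lemma hall_with_demands:
  assumes "finite U" "finite I"
    and "\<And>Y. Y \<subseteq> U \<Longrightarrow> sum d Y \<le> card {i\<in>I. i \<inter> Y \<noteq> {}}"
  shows "\<exists>A. (\<forall>u\<in>U. A u \<subseteq> {i\<in>I. u \<in> i} \<and> card (A u) = (d u :: nat)) \<and>
     (\<forall>u\<in>U. \<forall>w\<in>U. u \<noteq> w \<longrightarrow> A u \<inter> A w = {})"
  using assms
proof (induction "sum d U" arbitrary: d I)
  case 0
  then have "\<forall>u\<in>U. d u = 0" by simp
  then show ?case by (intro exI[of _ "\<lambda>u. {}"]) auto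
next
  case (Suc n)
  note finU = Suc.prems(1) and finI = Suc.prems(2) and hall = Suc.prems(3)
  define N where "N Y = {i\<in>I. i \<inter> Y \<noteq> {}}" for Y
  have finN: "finite (N Y)" for Y using finI unfolding N_def by simp
  have hall': "sum d Y \<le> card (N Y)" if "Y \<subseteq> U" for Y using hall[OF that] unfolding N_def .
  obtain u where u: "u \<in> U" "d u > 0"
    using Suc.hyps(2) by (metis gr_zeroI sum.neutral nat.distinct(1))
  define d' where "d' = d(u := d u - 1)"
  have sum_in: "sum d' Y + 1 = sum d Y" if "Y \<subseteq> U" "u \<in> Y" for Y
  proof -
    have "finite Y" using that finU finite_subset by blast
    then have "sum d Y = d u + sum d (Y - {u})" "sum d' Y = d' u + sum d' (Y - {u})"
      using that(2) by (auto intro: sum.remove)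
    moreover have "sum d' (Y - {u}) = sum d (Y - {u})" by (intro sum.cong) (auto simp: d'_def)
    ultimately show ?thesis using u(2) by (simp add: d'_def)
  qed
  have sum_out: "sum d' Y = sum d Y" if "u \<notin> Y" for Y
    using that by (intro sum.cong) (auto simp: d'_def)
  have "\<exists>i\<in>I. u \<in> i \<and> (\<forall>Y\<subseteq>U. sum d' Y \<le> card {j\<in>I - {i}. j \<inter> Y \<noteq> {}})"
  proof (rule ccontr)
    assume no: "\<not> ?thesis"
    have tight: "\<exists>Y\<subseteq>U. i \<inter> Y \<noteq> {} \<and> u \<notin> Y \<and> sum d Y = card (N Y)" if i: "i \<in> I" "u \<in> i" for i
    proof -
      obtain Y where Y: "Y \<subseteq> U" "card {j\<in>I - {i}. j \<inter> Y \<noteq> {}} < sum d' Y" using no i by (meson not_le)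
      have eq: "{j\<in>I - {i}. j \<inter> Y \<noteq> {}} = N Y - {i}" unfolding N_def by blast
      have c: "card (N Y - {i}) < sum d' Y" using Y(2) unfolding eq .
      have "card (N Y) \<le> card (N Y - {i}) + 1" using card_Suc_Diff1[OF finN, of i Y] by (cases "i \<in> N Y") auto
      then have nu: "u \<notin> Y" using c sum_in[OF Y(1)] hall'[OF Y(1)] by fastforce
      have "i \<in> N Y"
        using c sum_out[OF nu] hall'[OF Y(1)] by (cases "i \<in> N Y") auto
      moreover have "sum d Y = card (N Y)"
        using c sum_out[OF nu] hall'[OF Y(1)] \<open>card (N Y) \<le> card (N Y - {i}) + 1\<close> by linarith
      ultimately show ?thesis using Y(1) nu unfolding N_def by blast
    qed
    have union: "sum d (Y \<union> Z) = card (N (Y \<union> Z))"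
      if "Y \<subseteq> U" "Z \<subseteq> U" "sum d Y = card (N Y)" "sum d Z = card (N Z)" for Y Z
    proof -
      have "finite Y" "finite Z" using that finU finite_subset by blast+
      then have "sum d (Y \<union> Z) + sum d (Y \<inter> Z) = sum d Y + sum d Z" by (rule sum.union_inter)
      moreover have "card (N Y) + card (N Z) = card (N Y \<union> N Z) + card (N Y \<inter> N Z)"
        using card_Un_Int[OF finN finN] .
      moreover have "card (N (Y \<union> Z)) = card (N Y \<union> N Z)"
        unfolding N_def by (rule arg_cong[of _ _ card]) blast
      moreover have "card (N (Y \<inter> Z)) \<le> card (N Y \<inter> N Z)"
        by (rule card_mono) (use finN in \<open>auto simp: N_def\<close>)
      moreover have "sum d (Y \<inter> Z) \<le> card (N (Y \<inter> Z))" "sum d (Y \<union> Z) \<le> card (N (Y \<union> Z))"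
        using hall'[of "Y \<inter> Z"] hall'[of "Y \<union> Z"] that(1,2) by blast+
      ultimately show ?thesis using that(3,4) by linarith
    qed
    have "\<exists>Y. Y \<subseteq> U \<and> u \<notin> Y \<and> sum d Y = card (N Y) \<and> (\<forall>i\<in>I'. i \<inter> Y \<noteq> {})"
      if "finite I'" "I' \<subseteq> {i\<in>I. u \<in> i}" for I'
      using that
    proof (induction I')
      case empty
      have "N {} = {}" unfolding N_def by blast
      then show ?case by (intro exI[of _ "{}"]) simp
    next
      case (insert i I')
      obtain Y where Y: "Y \<subseteq> U" "u \<notin> Y" "sum d Y = card (N Y)" "\<forall>i\<in>I'. i \<inter> Y \<noteq> {}"
        using insert by blast
      obtain Z where Z: "Z \<subseteq> U" "i \<inter> Z \<noteq> {}" "u \<notin> Z" "sum d Z = card (N Z)"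
        using tight[of i] insert.prems by blast
      show ?case
      proof (intro exI[of _ "Y \<union> Z"] conjI ballI)
        fix j assume "j \<in> insert i I'" then show "j \<inter> (Y \<union> Z) \<noteq> {}" using Y(4) Z(2) by blast
      qed (use Y Z union in auto)
    qed
    from this[of "{i\<in>I. u \<in> i}"] finI obtain Y where
      Y: "Y \<subseteq> U" "u \<notin> Y" "sum d Y = card (N Y)" "\<And>i. i \<in> I \<Longrightarrow> u \<in> i \<Longrightarrow> i \<inter> Y \<noteq> {}" by auto
    have "N (insert u Y) = N Y" using Y(4) unfolding N_def by blast
    moreover have "finite Y" using Y(1) finU finite_subset by blast
    ultimately have "d u + sum d Y \<le> card (N Y)" using hall'[of "insert u Y"] u(1) Y(1,2) by simp
    then show False using u(2) Y(3) by simp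
  qed
  then obtain i where i: "i \<in> I" "u \<in> i" "\<And>Y. Y \<subseteq> U \<Longrightarrow> sum d' Y \<le> card {j\<in>I - {i}. j \<inter> Y \<noteq> {}}" by blast
  have "n = sum d' U" using sum_in[OF _ u(1)] Suc.hyps(2) by fastforce
  then have "\<exists>A. (\<forall>w\<in>U. A w \<subseteq> {j\<in>I - {i}. w \<in> j} \<and> card (A w) = d' w) \<and>
     (\<forall>v\<in>U. \<forall>w\<in>U. v \<noteq> w \<longrightarrow> A v \<inter> A w = {})"
    by (rule Suc.hyps(1)[OF _ finU _ i(3)]) (use finI in simp)
  then obtain A where A: "\<And>w. w \<in> U \<Longrightarrow> A w \<subseteq> {j\<in>I - {i}. w \<in> j} \<and> card (A w) = d' w"
      "\<And>v w. v \<in> U \<Longrightarrow> w \<in> U \<Longrightarrow> v \<noteq> w \<Longrightarrow> A v \<inter> A w = {}" by metis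
  have finA: "finite (A w)" if "w \<in> U" for w using A(1)[OF that] finI by (auto intro: finite_subset)
  have niA: "i \<notin> A w" if "w \<in> U" for w using A(1)[OF that] by blast
  define B where "B = A(u := insert i (A u))"
  have "card (B u) = d u" unfolding B_def using A(1)[OF u(1)] niA[OF u(1)] finA[OF u(1)] u(2) by (simp add: d'_def)
  then have "B w \<subseteq> {j\<in>I. w \<in> j} \<and> card (B w) = d w" if "w \<in> U" for w
    using A(1)[OF that] i(1,2) unfolding B_def d'_def by (cases "w = u") auto
  moreover have "B v \<inter> B w = {}" if "v \<in> U" "w \<in> U" "v \<noteq> w" for v w
    using A(2)[OF that] niA that unfolding B_def by auto
  ultimately show ?case by blast
qed

text \<open>
A constraint \<open>i\<close> has one vertex \<open>\<nu> i\<close> exempt from paying, but the exemption counts only if no vertex of \<open>i\<close>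
lies in \<open>X\<close>. For \<open>X = {}\<close> the numbers need not work out although the total \<open>\<Sum> |i| - 1\<close>
is at most two per vertex, because a subset may be overloaded; an overloaded
subset is moved into \<open>X\<close>. Precisely, \<open>X\<close> maximises the excess load \<open>f\<close> over the proper subsets.
Since \<open>f V \<le> 0 = f {}\<close>, it maximises \<open>f\<close> over all subsets, and comparing \<open>f (X \<union> Y)\<close> with \<open>f X\<close> gives
Hall's condition for every \<open>Y\<close> outside \<open>X\<close>, the demand of a vertex being its degree minus two.
\<close>

lemma orientation:
  fixes I :: "'a set set"
  assumes "finite V" "V \<noteq> {}" "finite I" and IV: "\<And>i. i \<in> I \<Longrightarrow> i \<subseteq> V \<and> i \<noteq> {}"
    and count: "(\<Sum>i\<in>I. card i - 1) \<le> 2 * card V"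
  shows "\<exists>X \<nu>. X \<subset> V \<and> (\<forall>i\<in>I. \<nu> i \<in> i) \<and>
     (\<forall>u\<in>V - X. card {i\<in>I. u \<in> i \<and> \<not> (i \<subseteq> V - X \<and> \<nu> i = u)} \<le> 2)"
proof -
  define f where "f Z = (\<Sum>i\<in>I. int (card (i \<inter> Z) - 1)) - 2 * int (card Z)" for Z
  have fini: "finite i" if "i \<in> I" for i using IV[OF that] assms(1) finite_subset by blast
  have "finite (Pow V - {V})" "{} \<in> Pow V - {V}" using assms(1,2) by auto
  then have "Max (f ` (Pow V - {V})) \<in> f ` (Pow V - {V})"
    by (metis Max_in empty_iff finite_imageI image_is_empty)
  then obtain X where X: "X \<in> Pow V - {V}" "f X = Max (f ` (Pow V - {V}))" by (metis imageE)
  then have best: "f Z \<le> f X" if "Z \<in> Pow V - {V}" for Z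
    using that \<open>finite (Pow V - {V})\<close> by simp
  have "f {} = 0" unfolding f_def by simp
  moreover have "f V \<le> 0"
  proof -
    have "(\<Sum>i\<in>I. int (card (i \<inter> V) - 1)) = int (\<Sum>i\<in>I. card i - 1)"
      unfolding of_nat_sum using IV by (intro sum.cong) (auto simp: Int_absorb2)
    then show ?thesis unfolding f_def using count by linarith
  qed
  ultimately have "f V \<le> f X" using best[of "{}"] assms(2) by auto
  then have max: "f Z \<le> f X" if "Z \<subseteq> V" for Z using best[of Z] that by (cases "Z = V") auto
  define U where "U = V - X"
  have finU: "finite U" and finX: "finite X" using assms(1) X(1) finite_subset unfolding U_def by auto
  define IU where "IU = {i\<in>I. i \<subseteq> U}"
  define deg where "deg u = card {i\<in>I. u \<in> i}" for u
  have key: "sum deg Y \<le> 2 * card Y + card {i\<in>IU. i \<inter> Y \<noteq> {}}" if Y: "Y \<subseteq> U" for Y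
  proof -
    have finY: "finite Y" using Y finU finite_subset by blast
    have XY: "X \<inter> Y = {}" "X \<union> Y \<subseteq> V" using Y X(1) unfolding U_def by auto
    (* The truncation at 0 matters exactly for the constraints disjoint from X. *)
    have inc: "int (card (i \<inter> (X \<union> Y)) - 1) = int (card (i \<inter> X) - 1) + int (card {y\<in>Y. y \<in> i})
         - (if i \<in> IU \<and> i \<inter> Y \<noteq> {} then 1 else 0)" if i: "i \<in> I" for i
    proof -
      have "card (i \<inter> (X \<union> Y)) = card (i \<inter> X) + card (i \<inter> Y)"
        unfolding Int_Un_distrib using XY(1) fini[OF i] by (intro card_Un_disjoint) auto
      moreover have "{y\<in>Y. y \<in> i} = i \<inter> Y" by blast
      moreover have "i \<in> IU \<longleftrightarrow> card (i \<inter> X) = 0"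
        using IV[OF i] i fini[OF i] unfolding IU_def U_def by auto
      moreover have "i \<inter> Y \<noteq> {} \<longleftrightarrow> card (i \<inter> Y) > 0" using fini[OF i] by (simp add: card_gt_0_iff)
      ultimately show ?thesis by auto
    qed
    have "f (X \<union> Y) = f X + (\<Sum>i\<in>I. int (card {y\<in>Y. y \<in> i})) - int (card {i\<in>IU. i \<inter> Y \<noteq> {}}) - 2 * int (card Y)"
    proof -
      have "{i\<in>I. i \<in> IU \<and> i \<inter> Y \<noteq> {}} = {i\<in>IU. i \<inter> Y \<noteq> {}}" unfolding IU_def by blast
      then have "(\<Sum>i\<in>I. if i \<in> IU \<and> i \<inter> Y \<noteq> {} then 1 else (0::int)) = int (card {i\<in>IU. i \<inter> Y \<noteq> {}})"
        using assms(3) by (simp add: sum.If_cases Int_def)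
      moreover have "card (X \<union> Y) = card X + card Y" using XY finX finY by (simp add: card_Un_disjoint)
      ultimately show ?thesis unfolding f_def using inc by (simp add: sum.distrib sum_subtractf)
    qed
    moreover have "f (X \<union> Y) \<le> f X" using max XY(2) by blast
    moreover have "(\<Sum>i\<in>I. card {y\<in>Y. y \<in> i}) = sum deg Y"
      using double_count[OF assms(3) finY, of "\<lambda>i y. y \<in> i"] unfolding deg_def by simp
    then have "(\<Sum>i\<in>I. int (card {y\<in>Y. y \<in> i})) = int (sum deg Y)" by (simp flip: of_nat_sum)
    ultimately show ?thesis by linarith
  qed
  have "sum (\<lambda>u. deg u - 2) Y \<le> card {i\<in>IU. i \<inter> Y \<noteq> {}}" if Y: "Y \<subseteq> U" for Y
  proof -
    define Z where "Z = {u\<in>Y. deg u \<ge> 2}"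
    have finY: "finite Y" using Y finU finite_subset by blast
    have "sum (\<lambda>u. deg u - 2) Y = sum (\<lambda>u. deg u - 2) Z"
      unfolding Z_def using finY by (intro sum.mono_neutral_right) auto
    moreover have "sum (\<lambda>u. deg u - 2) Z + 2 * card Z = sum deg Z"
    proof -
      have "sum (\<lambda>u. deg u - 2) Z + 2 * card Z = sum (\<lambda>u. deg u - 2 + 2) Z" by (subst sum.distrib) simp
      also have "\<dots> = sum deg Z" unfolding Z_def by (intro sum.cong) auto
      finally show ?thesis .
    qed
    moreover have "sum deg Z \<le> 2 * card Z + card {i\<in>IU. i \<inter> Z \<noteq> {}}" using key[of Z] Y unfolding Z_def by blast
    moreover have "card {i\<in>IU. i \<inter> Z \<noteq> {}} \<le> card {i\<in>IU. i \<inter> Y \<noteq> {}}"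
      using assms(3) by (intro card_mono) (auto simp: IU_def Z_def)
    ultimately show ?thesis by linarith
  qed
  moreover have "finite IU" unfolding IU_def using assms(3) by simp
  ultimately have "\<exists>A. (\<forall>u\<in>U. A u \<subseteq> {i\<in>IU. u \<in> i} \<and> card (A u) = deg u - 2) \<and>
     (\<forall>u\<in>U. \<forall>w\<in>U. u \<noteq> w \<longrightarrow> A u \<inter> A w = {})"
    by (intro hall_with_demands[OF finU])
  then obtain A where "(\<forall>u\<in>U. A u \<subseteq> {i\<in>IU. u \<in> i} \<and> card (A u) = deg u - 2) \<and>
     (\<forall>u\<in>U. \<forall>w\<in>U. u \<noteq> w \<longrightarrow> A u \<inter> A w = {})" by (elim exE)
  then have A: "\<And>u. u \<in> U \<Longrightarrow> A u \<subseteq> {i\<in>IU. u \<in> i} \<and> card (A u) = deg u - 2"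
     "\<And>u w. u \<in> U \<Longrightarrow> w \<in> U \<Longrightarrow> u \<noteq> w \<Longrightarrow> A u \<inter> A w = {}" by simp_all
  define \<nu> where "\<nu> i = (if \<exists>u\<in>U. i \<in> A u then SOME u. u \<in> U \<and> i \<in> A u else SOME u. u \<in> i)" for i
  have nuA: "\<nu> i = u" if "u \<in> U" "i \<in> A u" for i u
  proof -
    have "(SOME u. u \<in> U \<and> i \<in> A u) = u" by (rule some_equality) (use that A(2) in auto)
    then show ?thesis unfolding \<nu>_def using that by auto
  qed
  show ?thesis
  proof (intro exI[of _ X] exI[of _ \<nu>] conjI ballI)
    show "X \<subset> V" using X(1) by auto
    fix i assume i: "i \<in> I"
    show "\<nu> i \<in> i"
    proof (cases "\<exists>u\<in>U. i \<in> A u")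
      case True then show ?thesis using nuA A(1) by auto
    next
      case False then show ?thesis unfolding \<nu>_def using IV[OF i] some_in_eq by auto
    qed
  next
    fix u assume "u \<in> V - X"
    then have u: "u \<in> U" unfolding U_def .
    have "{i\<in>I. u \<in> i \<and> \<not> (i \<subseteq> V - X \<and> \<nu> i = u)} \<subseteq> {i\<in>I. u \<in> i} - A u"
      using nuA[OF u] A(1)[OF u] unfolding IU_def U_def by blast
    then have "card {i\<in>I. u \<in> i \<and> \<not> (i \<subseteq> V - X \<and> \<nu> i = u)} \<le> card ({i\<in>I. u \<in> i} - A u)"
      using assms(3) by (intro card_mono) auto
    also have "\<dots> = deg u - card (A u)" unfolding deg_def
      using A(1)[OF u] assms(3) by (intro card_Diff_subset) (auto simp: IU_def intro: finite_subset)
    also have "\<dots> \<le> 2" using A(1)[OF u] by simp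
    finally show "card {i\<in>I. u \<in> i \<and> \<not> (i \<subseteq> V - X \<and> \<nu> i = u)} \<le> 2" .
  qed
qed

text \<open>
\<open>hyperforest H \<kappa>\<close> says that the hyperedges in \<open>H\<close> can be added one by one such that each of them meets every
current component at most once; \<open>\<kappa>\<close> maps each vertex to a representative of its component. On
graphs these are the forests.
\<close>

inductive hyperforest :: "'a set set \<Rightarrow> ('a \<Rightarrow> 'a) \<Rightarrow> bool" where
  empty: "hyperforest {} id"
| insert: "hyperforest H \<kappa> \<Longrightarrow> finite S \<Longrightarrow> inj_on \<kappa> S \<Longrightarrow> s \<in> S \<Longrightarrow>
     hyperforest (insert S H) (\<lambda>v. if \<kappa> v \<in> \<kappa> ` S then \<kappa> s else \<kappa> v)"

lemma hyperforest_const: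
  assumes "hyperforest H \<kappa>" "S \<in> H" "u \<in> S" "v \<in> S" shows "\<kappa> u = \<kappa> v"
  using assms
proof (induction rule: hyperforest.induct)
  case (insert H \<kappa> T s)
  show ?case
  proof (cases "S \<in> H")
    case True then show ?thesis using insert by simp
  next
    case False
    then have "S = T" using insert by blast
    then show ?thesis using insert.prems by simp
  qed
qed simp

lemma hyperforest_finite: "hyperforest H \<kappa> \<Longrightarrow> finite H"
  by (induction rule: hyperforest.induct) auto

text \<open>
Adding the hyperedge \<open>S\<close> merges \<open>|S|\<close> components into one.
\<close>

lemma hyperforest_count:
  assumes "hyperforest H \<kappa>" "finite V"
  shows "card V \<le> card (\<kappa> ` V) + (\<Sum>S\<in>H. card S - 1)"
  using assms(1)
proof (induction rule: hyperforest.induct)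
  case empty show ?case by simp
next
  case (insert H \<kappa> S s)
  let ?k = "\<lambda>v. if \<kappa> v \<in> \<kappa> ` S then \<kappa> s else \<kappa> v"
  have "card (\<kappa> ` S - {\<kappa> s}) = card S - 1"
    using insert.hyps by (simp add: card_image card_Diff_singleton)
  moreover have "\<kappa> ` V \<subseteq> ?k ` V \<union> (\<kappa> ` S - {\<kappa> s})"
  proof
    fix x assume "x \<in> \<kappa> ` V"
    then obtain v where v: "v \<in> V" "x = \<kappa> v" by blast
    have "?k v \<in> ?k ` V" using v(1) by (rule imageI)
    then show "x \<in> ?k ` V \<union> (\<kappa> ` S - {\<kappa> s})" using v(2) by (cases "\<kappa> v \<in> \<kappa> ` S"; cases "\<kappa> v = \<kappa> s") auto
  qed
  then have "card (\<kappa> ` V) \<le> card (?k ` V \<union> (\<kappa> ` S - {\<kappa> s}))"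
    using assms(2) insert.hyps(2) by (intro card_mono) auto
  then have "card (\<kappa> ` V) \<le> card (?k ` V) + card (\<kappa> ` S - {\<kappa> s})" using card_Un_le le_trans by blast
  ultimately have step: "card (\<kappa> ` V) \<le> card (?k ` V) + (card S - 1)" by simp
  show ?case
  proof (cases "S \<in> H")
    case True
    have "u = v" if "u \<in> S" "v \<in> S" for u v
      using inj_onD[OF insert.hyps(3)] hyperforest_const[OF insert.hyps(1) True] that by blast
    then have "card S \<le> Suc 0" using insert.hyps(2) card_le_Suc0_iff_eq by blast
    then show ?thesis using step insert.IH True by (simp add: insert_absorb)
  next
    case False
    then show ?thesis using step insert.IH hyperforest_finite[OF insert.hyps(1)] by simp
  qed
qed

text \<open>
Whatever vertex of each hyperedge is chosen, some order begins every hyperedge with its chosen vertex.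
When \<open>S\<close> is added, the component of its chosen vertex keeps its ranks, and all others are shifted
beyond the rank of that vertex; this does not disturb older hyperedges, as each of them lies in one component.
\<close>

lemma hyperforest_rank:
  assumes "hyperforest H \<kappa>" "\<And>S. S \<in> H \<Longrightarrow> \<nu> S \<in> S"
  shows "\<exists>r::'a \<Rightarrow> nat. \<forall>S\<in>H. \<forall>w\<in>S. w \<noteq> \<nu> S \<longrightarrow> r (\<nu> S) < r w"
  using assms
proof (induction rule: hyperforest.induct)
  case empty show ?case by simp
next
  case (insert H \<kappa> S s)
  then obtain r :: "'a \<Rightarrow> nat" where r: "\<And>T w. T \<in> H \<Longrightarrow> w \<in> T \<Longrightarrow> w \<noteq> \<nu> T \<Longrightarrow> r (\<nu> T) < r w" by blast
  define r' where "r' v = (if \<kappa> v = \<kappa> (\<nu> S) then r v else r v + r (\<nu> S) + 1)" for v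
  have "r' (\<nu> T) < r' w" if T: "T \<in> insert S H" "w \<in> T" "w \<noteq> \<nu> T" for T w
  proof (cases "T \<in> H")
    case True
    have "\<nu> T \<in> T" using insert.prems T(1) .
    then have "\<kappa> (\<nu> T) = \<kappa> w" using hyperforest_const[OF insert.hyps(1) True] T(2) by blast
    then show ?thesis using r[OF True T(2,3)] unfolding r'_def by auto
  next
    case False
    then have "T = S" using T(1) by blast
    then have "\<kappa> w \<noteq> \<kappa> (\<nu> S)" using insert.hyps(3) insert.prems[of S] T by (auto simp: inj_on_def)
    then show ?thesis using \<open>T = S\<close> unfolding r'_def by auto
  qed
  then show ?case by blast
qed

text \<open>
Passing to a vertex subset and keeping only the traces of size two leaves a forest. Its components are
contained in the old ones, which is what the induction needs.
\<close>

lemma hyperforest_restrict: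
  assumes "hyperforest H \<kappa>"
  shows "\<exists>\<kappa>'. hyperforest {R. \<exists>S\<in>H. R = S \<inter> X \<and> card R = 2} \<kappa>' \<and> (\<forall>u v. \<kappa>' u = \<kappa>' v \<longrightarrow> \<kappa> u = \<kappa> v)"
  using assms
proof (induction rule: hyperforest.induct)
  case empty 
  have "{R. \<exists>S\<in>{}. R = S \<inter> X \<and> card R = 2} = {}" by simp
  then show ?case using hyperforest.empty by (intro exI[of _ id]) (simp add: id_def)
next
  case (insert H \<kappa> S s)
  let ?H = "\<lambda>H. {R. \<exists>S\<in>H. R = S \<inter> X \<and> card R = 2}"
  let ?k = "\<lambda>v. if \<kappa> v \<in> \<kappa> ` S then \<kappa> s else \<kappa> v"
  obtain \<kappa>' where k: "hyperforest (?H H) \<kappa>'" "\<And>u v. \<kappa>' u = \<kappa>' v \<Longrightarrow> \<kappa> u = \<kappa> v" using insert.IH by blast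
  show ?case
  proof (cases "card (S \<inter> X) = 2")
    case False
    then have e: "?H (insert S H) = ?H H" by blast
    have "?k u = ?k v" if "\<kappa>' u = \<kappa>' v" for u v unfolding k(2)[OF that] ..
    then show ?thesis unfolding e by (intro exI[of _ \<kappa>'] conjI allI impI k(1))
  next
    case True
    then have eq: "?H (insert S H) = insert (S \<inter> X) (?H H)" by blast
    have "S \<inter> X \<noteq> {}" using True by (metis card.empty zero_neq_numeral)
    then obtain t where t: "t \<in> S \<inter> X" by blast
    have inj: "inj_on \<kappa>' (S \<inter> X)"
    proof (rule inj_onI)
      fix x y assume xy: "x \<in> S \<inter> X" "y \<in> S \<inter> X" "\<kappa>' x = \<kappa>' y"
      show "x = y" by (rule inj_onD[OF insert.hyps(3) k(2)[OF xy(3)]]) (use xy in auto)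
    qed
    let ?k' = "\<lambda>v. if \<kappa>' v \<in> \<kappa>' ` (S \<inter> X) then \<kappa>' t else \<kappa>' v"
    have "hyperforest (?H (insert S H)) ?k'"
      unfolding eq using hyperforest.insert[OF k(1) _ inj t] insert.hyps(2) by simp
    moreover have "?k u = ?k v" if e: "?k' u = ?k' v" for u v
    proof -
      have in': "\<kappa> w \<in> \<kappa> ` S" if w: "\<kappa>' w \<in> \<kappa>' ` (S \<inter> X)" for w
      proof -
        obtain z where "z \<in> S" "\<kappa>' w = \<kappa>' z" using w by blast
        then show ?thesis using k(2)[of w z] by simp
      qed
      have tt: "\<kappa>' t \<in> \<kappa>' ` (S \<inter> X)" using t by blast
      consider "\<kappa>' u \<in> \<kappa>' ` (S \<inter> X)" "\<kappa>' v \<in> \<kappa>' ` (S \<inter> X)" | "\<kappa>' u = \<kappa>' v"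
        using e tt by (metis (full_types))
      then show ?thesis
      proof cases
        case 1 
        then have "\<kappa> u \<in> \<kappa> ` S" "\<kappa> v \<in> \<kappa> ` S" using in' by blast+
        then show ?thesis by simp
      next
        case 2 show ?thesis unfolding k(2)[OF 2] ..
      qed
    qed
    ultimately show ?thesis by (intro exI[of _ ?k'] conjI allI impI)
  qed
qed

section \<open>Sparse graphs with edge-disjoint triangles\<close>

lemma card3_eq:
  assumes "card T = 3" "a \<in> T" "b \<in> T" "c \<in> T" "a \<noteq> b" "a \<noteq> c" "b \<noteq> c"
  shows "T = {a,b,c}"
proof -
  have "finite T" using assms(1) card.infinite by fastforce
  then have "{a,b,c} = T" using assms by (intro card_subset_eq) auto
  then show ?thesis ..
qed

lemma tri_edge: assumes "T \<in> triangles E" "e \<subseteq> T" "card e = 2" shows "e \<in> E"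
proof -
  obtain a b where "e = {a,b}" "a \<noteq> b" using assms(3) by (meson card_2_iff)
  then show ?thesis using assms(1,2) unfolding triangles_def by simp
qed

lemma tri_card: "T \<in> triangles E \<Longrightarrow> card T = 3" unfolding triangles_def by simp

lemma sum_over_classes:
  assumes "finite V" "finite A" "\<And>e. e \<in> A \<Longrightarrow> e \<subseteq> V \<and> e \<noteq> {}"
  shows "(\<Sum>c\<in>\<kappa> ` V. card {e\<in>A. e \<subseteq> {v\<in>V. \<kappa> v = c}}) = card {e\<in>A. \<forall>x\<in>e. \<forall>y\<in>e. \<kappa> x = \<kappa> y}"
proof -
  let ?B = "\<lambda>c. {e\<in>A. e \<subseteq> {v\<in>V. \<kappa> v = c}}"
  have eq: "{e\<in>A. \<forall>x\<in>e. \<forall>y\<in>e. \<kappa> x = \<kappa> y} = (\<Union>c\<in>\<kappa> ` V. ?B c)"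
  proof (intro equalityI subsetI)
    fix e assume e: "e \<in> {e\<in>A. \<forall>x\<in>e. \<forall>y\<in>e. \<kappa> x = \<kappa> y}"
    then have "e \<in> A" by simp
    then obtain x where x: "x \<in> e" "x \<in> V" using assms(3)[of e] by blast
    have "\<forall>y\<in>e. \<kappa> y = \<kappa> x" using e x(1) by blast
    then have "e \<in> ?B (\<kappa> x)" using \<open>e \<in> A\<close> assms(3)[OF \<open>e \<in> A\<close>] by blast
    then show "e \<in> (\<Union>c\<in>\<kappa> ` V. ?B c)" using x(2) by blast
  next
    fix e assume "e \<in> (\<Union>c\<in>\<kappa> ` V. ?B c)"
    then obtain c where "e \<in> ?B c" by blast
    then have "e \<in> A" "\<forall>x\<in>e. \<kappa> x = c" by auto
    then show "e \<in> {e\<in>A. \<forall>x\<in>e. \<forall>y\<in>e. \<kappa> x = \<kappa> y}" by simp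
  qed
  have "?B c \<inter> ?B d = {}" if "c \<noteq> d" for c d
  proof (rule equals0I)
    fix e assume e: "e \<in> ?B c \<inter> ?B d"
    then obtain x where "x \<in> e" using assms(3)[of e] by blast
    then show False using e that by auto
  qed
  then show ?thesis unfolding eq using assms(1,2) by (subst card_UN_disjoint) auto
qed

locale sparse_graph =
  fixes V0 :: "'a set" and E :: "'a set set"
  assumes finV0: "finite V0"
    and edge: "e \<in> E \<Longrightarrow> e \<subseteq> V0 \<and> card e = 2"
    and sparse: "sparse V0 E"
    and tri_unique: "T \<in> triangles E \<Longrightarrow> T' \<in> triangles E \<Longrightarrow> e \<subseteq> T \<Longrightarrow> e \<subseteq> T' \<Longrightarrow> card e = 2 \<Longrightarrow> T = T'"
begin

abbreviation edges_in :: "'a set \<Rightarrow> 'a set set" where "edges_in V \<equiv> {e\<in>E. e \<subseteq> V}"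
abbreviation triangles_in :: "'a set \<Rightarrow> 'a set set" where "triangles_in V \<equiv> {T\<in>triangles E. T \<subseteq> V}"

lemma finite_ind: assumes "V \<subseteq> V0" shows "finite (edges_in V)" "finite (triangles_in V)"
proof -
  have "finite (Pow V)" using assms finV0 finite_subset by blast
  then show "finite (edges_in V)" "finite (triangles_in V)" by (auto elim: rev_finite_subset)
qed

text \<open>
By maximality, every triangle has two vertices in the same component of the forest, so it
contributes an edge inside a component, and even three if it lies in a component. The triangles being edge-disjoint,
this bounds the number of edges inside components from below, whereas sparsity of
the components bounds it from above; there are many components because the forest has few hyperedges.
\<close>

lemma edge_bound:
  assumes V: "V \<subseteq> V0" "V \<noteq> {}" and forest: "hyperforest (DE \<union> \<D>) \<kappa>"
    and DE: "DE \<subseteq> edges_in V" "\<And>e T. e \<in> DE \<Longrightarrow> T \<in> triangles_in V \<Longrightarrow> \<not> e \<subseteq> T"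
    and \<D>: "\<D> \<subseteq> triangles_in V" and max: "\<And>T. T \<in> triangles_in V - \<D> \<Longrightarrow> \<not> inj_on \<kappa> T"
  shows "card (edges_in V) \<le> 2 * card V + card \<D>"
proof -
  have finV: "finite V" using V(1) finV0 finite_subset by blast
  note fin = finite_ind[OF V(1)]
  have finDE: "finite DE" "finite \<D>" using finite_subset[OF DE(1) fin(1)] finite_subset[OF \<D> fin(2)] .
  define M where "M e \<longleftrightarrow> (\<forall>x\<in>e. \<forall>y\<in>e. \<kappa> x = \<kappa> y)" for e
  define In where "In T = {e. e \<subseteq> T \<and> card e = 2}" for T :: "'a set"
  define P where "P T = {e\<in>In T. M e}" for T
  have InE: "In T \<subseteq> edges_in V" if "T \<in> triangles_in V" for T using tri_edge that unfolding In_def by blast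
  have cIn: "card (In T) = 3" if "T \<in> triangles_in V" for T
  proof -
    have "card T = 3" using tri_card that by blast
    moreover have "finite T" using that finV finite_subset by blast
    ultimately show ?thesis unfolding In_def using n_subsets[of T 2] by (simp add: numeral_eq_Suc)
  qed
  have disj: "In T \<inter> In T' = {}" if "T \<in> triangles_in V" "T' \<in> triangles_in V" "T \<noteq> T'" for T T'
    using tri_unique that unfolding In_def by blast
  have finIn: "finite (In T)" if "T \<in> triangles_in V" for T using InE[OF that] fin(1) finite_subset by blast
  have disjDE: "In T \<inter> DE = {}" if "T \<in> triangles_in V" for T using DE(2) that unfolding In_def by blast
  (* Edge-disjointness of the triangles and of the forest edges, used for all edges and for those inside components. *)
  have many: "(\<Sum>T\<in>triangles_in V. card (Q T)) + card DE \<le> card R"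
    if Q: "\<And>T. T \<in> triangles_in V \<Longrightarrow> Q T \<subseteq> In T" "\<And>T. T \<in> triangles_in V \<Longrightarrow> Q T \<subseteq> R" and R: "DE \<subseteq> R" "finite R" for Q R
  proof -
    have "(\<Sum>T\<in>triangles_in V. card (Q T)) = card (\<Union>T\<in>triangles_in V. Q T)"
    proof (rule card_UN_disjoint[symmetric])
      show "\<forall>T\<in>triangles_in V. finite (Q T)" using Q(1) finIn finite_subset by metis
      show "\<forall>T\<in>triangles_in V. \<forall>T'\<in>triangles_in V. T \<noteq> T' \<longrightarrow> Q T \<inter> Q T' = {}"
      proof (intro ballI impI)
        fix T T' assume "T \<in> triangles_in V" "T' \<in> triangles_in V" "T \<noteq> T'"
        then show "Q T \<inter> Q T' = {}" using Q(1)[of T] Q(1)[of T'] disj[of T T'] by blast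
      qed
    qed (rule fin)
    moreover have UR: "(\<Union>T\<in>triangles_in V. Q T) \<subseteq> R" by (rule UN_least) (rule Q(2))
    moreover have "card ((\<Union>T\<in>triangles_in V. Q T) \<union> DE) = card (\<Union>T\<in>triangles_in V. Q T) + card DE"
    proof (rule card_Un_disjoint)
      show "finite (\<Union>T\<in>triangles_in V. Q T)" using UR R(2) by (rule finite_subset)
      show "(\<Union>T\<in>triangles_in V. Q T) \<inter> DE = {}"
      proof (rule equals0I)
        fix e assume "e \<in> (\<Union>T\<in>triangles_in V. Q T) \<inter> DE"
        then obtain T where "T \<in> triangles_in V" "e \<in> Q T" "e \<in> DE" by blast
        then show False using Q(1)[of T] disjDE[of T] by blast
      qed
    qed (rule finDE)
    moreover have "card ((\<Union>T\<in>triangles_in V. Q T) \<union> DE) \<le> card R"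
      by (rule card_mono[OF R(2) Un_least[OF UR R(1)]])
    ultimately show ?thesis by simp
  qed
  have "(\<Sum>T\<in>triangles_in V. card (In T)) + card DE \<le> card (edges_in V)"
    by (rule many) (use InE DE(1) fin(1) in auto)
  then have total: "3 * card (triangles_in V) + card DE \<le> card (edges_in V)" using cIn by simp
  have constD: "M S" if "S \<in> DE \<union> \<D>" for S using hyperforest_const[OF forest that] unfolding M_def by blast
  define ec where "ec = card {e\<in>edges_in V. M e}"
  define tc where "tc = card {T\<in>triangles_in V. M T}"
  have "(\<Sum>T\<in>triangles_in V. card (P T)) + card DE \<le> ec" unfolding ec_def
  proof (rule many)
    show "P T \<subseteq> In T" for T unfolding P_def by blast
    show "P T \<subseteq> {e\<in>edges_in V. M e}" if "T \<in> triangles_in V" for T using InE[OF that] unfolding P_def by blast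
    show "DE \<subseteq> {e\<in>edges_in V. M e}" using DE(1) constD by blast
    show "finite {e\<in>edges_in V. M e}" using fin(1) by (rule rev_finite_subset) blast
  qed
  moreover have "card (triangles_in V) + 2 * tc \<le> (\<Sum>T\<in>triangles_in V. card (P T))"
  proof -
    have "card (triangles_in V) + 2 * tc = (\<Sum>T\<in>triangles_in V. 1 + (if M T then 2 else 0))"
      unfolding tc_def using fin(2) by (subst sum.distrib) (simp add: sum.If_cases Int_def conj_assoc)
    also have "\<dots> \<le> (\<Sum>T\<in>triangles_in V. card (P T))"
    proof (rule sum_mono)
      fix T assume T: "T \<in> triangles_in V"
      show "1 + (if M T then 2 else 0) \<le> card (P T)"
      proof (cases "M T")
        case True
        then have "P T = In T" unfolding P_def In_def M_def by blast
        then show ?thesis using cIn[OF T] True by simp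
      next
        case False
        then have "T \<notin> \<D>" using constD by blast
        then have "\<not> inj_on \<kappa> T" using max T by blast
        then obtain x y where xy: "x \<in> T" "y \<in> T" "x \<noteq> y" "\<kappa> x = \<kappa> y" unfolding inj_on_def by blast
        then have "{x,y} \<in> P T" unfolding P_def In_def M_def by auto
        moreover have "finite (P T)" using finIn[OF T] unfolding P_def by simp
        ultimately have "card (P T) > 0" by (auto simp: card_gt_0_iff)
        then show ?thesis using False by simp
      qed
    qed
    finally show ?thesis .
  qed
  ultimately have mono: "card (triangles_in V) + 2 * tc + card DE \<le> ec" by linarith
  have "card \<D> \<le> tc" unfolding tc_def by (rule card_mono[OF rev_finite_subset[OF fin(2)]]) (use \<D> constD in blast)+
  define Y where "Y c = {v\<in>V. \<kappa> v = c}" for c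
  have "(\<Sum>c\<in>\<kappa> ` V. 3 * card (edges_in (Y c)) + 5) \<le> (\<Sum>c\<in>\<kappa> ` V. 5 * card (Y c) + 2 * card (triangles_in (Y c)))"
  proof (rule sum_mono)
    fix c assume "c \<in> \<kappa> ` V"
    then have "Y c \<noteq> {}" "Y c \<subseteq> V0" using V(1) unfolding Y_def by auto
    then show "3 * card (edges_in (Y c)) + 5 \<le> 5 * card (Y c) + 2 * card (triangles_in (Y c))"
      using sparse unfolding sparse_def by simp
  qed
  then have cl: "3 * (\<Sum>c\<in>\<kappa> ` V. card (edges_in (Y c))) + 5 * card (\<kappa> ` V)
    \<le> 5 * (\<Sum>c\<in>\<kappa> ` V. card (Y c)) + 2 * (\<Sum>c\<in>\<kappa> ` V. card (triangles_in (Y c)))"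
    by (simp add: sum.distrib sum_distrib_left)
  have "Y c \<subseteq> V" for c unfolding Y_def by blast
  then have sub: "edges_in (Y c) = {e\<in>edges_in V. e \<subseteq> Y c}" "triangles_in (Y c) = {T\<in>triangles_in V. T \<subseteq> Y c}" for c by blast+
  have ne: "e \<subseteq> V \<and> e \<noteq> {}" if "e \<in> edges_in V" for e using that edge[of e] by auto
  have neT: "T \<subseteq> V \<and> T \<noteq> {}" if "T \<in> triangles_in V" for T using that tri_nonempty by blast
  have "(\<Sum>c\<in>\<kappa> ` V. card (edges_in (Y c))) = (\<Sum>c\<in>\<kappa> ` V. card {e\<in>edges_in V. e \<subseteq> Y c})"
    by (rule sum.cong[OF refl]) (rule arg_cong[of _ _ card], rule sub(1))
  also have "\<dots> = ec" unfolding ec_def M_def Y_def by (rule sum_over_classes[OF finV fin(1) ne])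
  finally have "(\<Sum>c\<in>\<kappa> ` V. card (edges_in (Y c))) = ec" .
  moreover have "(\<Sum>c\<in>\<kappa> ` V. card (triangles_in (Y c))) = tc"
  proof -
    have "(\<Sum>c\<in>\<kappa> ` V. card (triangles_in (Y c))) = (\<Sum>c\<in>\<kappa> ` V. card {T\<in>triangles_in V. T \<subseteq> Y c})"
      by (rule sum.cong[OF refl]) (rule arg_cong[of _ _ card], rule sub(2))
    also have "\<dots> = tc" unfolding tc_def M_def Y_def by (rule sum_over_classes[OF finV fin(2) neT])
    finally show ?thesis .
  qed
  moreover have "(\<Sum>c\<in>\<kappa> ` V. card (Y c)) = card V"
    using sum.image_gen[OF finV, of "\<lambda>_. 1::nat" \<kappa>] unfolding Y_def by simp
  ultimately have classes: "3 * ec + 5 * card (\<kappa> ` V) \<le> 5 * card V + 2 * tc" using cl by simp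
  have "card V \<le> card (\<kappa> ` V) + (\<Sum>S\<in>DE \<union> \<D>. card S - 1)" by (rule hyperforest_count[OF forest finV])
  moreover have "(\<Sum>S\<in>DE \<union> \<D>. card S - 1) = card DE + 2 * card \<D>"
  proof -
    have c2: "card S = 2" if "S \<in> DE" for S using that DE(1) edge by blast
    have c3: "card S = 3" if "S \<in> \<D>" for S using that \<D> tri_card by blast
    have "DE \<inter> \<D> = {}" using c2 c3 by force
    then show ?thesis using finDE c2 c3 by (simp add: sum.union_disjoint)
  qed
  moreover have "3 * card (edges_in V) + 5 \<le> 5 * card V + 2 * card (triangles_in V)"
    using sparse V unfolding sparse_def by simp
  ultimately show ?thesis using classes mono total \<open>card \<D> \<le> tc\<close> by linarith
qed

lemma maximal_forest:
  assumes V: "V \<subseteq> V0" and "hyperforest DE \<kappa>"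
  obtains \<D> \<kappa>' where "\<D> \<subseteq> triangles_in V" "hyperforest (DE \<union> \<D>) \<kappa>'" "\<And>T. T \<in> triangles_in V - \<D> \<Longrightarrow> \<not> inj_on \<kappa>' T"
proof -
  let ?F = "{\<D>\<in>Pow (triangles_in V). \<exists>\<kappa>. hyperforest (DE \<union> \<D>) \<kappa>}"
  have "finite ?F" using finite_ind(2)[OF V] by simp
  moreover have "{} \<in> ?F" using assms(2) by auto
  ultimately obtain \<D> where D: "\<D> \<in> ?F" "\<And>\<D>'. \<D>' \<in> ?F \<Longrightarrow> \<D> \<subseteq> \<D>' \<Longrightarrow> \<D> = \<D>'"
    using finite_has_maximal[of ?F] by (metis (no_types, lifting) empty_iff)
  then obtain \<kappa>' where k: "hyperforest (DE \<union> \<D>) \<kappa>'" by blast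
  show thesis
  proof (rule that[OF _ k])
    show "\<D> \<subseteq> triangles_in V" using D(1) by blast
    fix T assume T: "T \<in> triangles_in V - \<D>"
    show "\<not> inj_on \<kappa>' T"
    proof
      assume inj: "inj_on \<kappa>' T"
      have c: "card T = 3" using T tri_card by blast
      then have "finite T" using card.infinite by fastforce
      moreover obtain s where "s \<in> T" using c by fastforce
      ultimately have "hyperforest (insert T (DE \<union> \<D>)) (\<lambda>v. if \<kappa>' v \<in> \<kappa>' ` T then \<kappa>' s else \<kappa>' v)"
        using hyperforest.insert[OF k _ inj] by blast
      moreover have "insert T (DE \<union> \<D>) = DE \<union> insert T \<D>" by blast
      ultimately have "\<exists>\<kappa>. hyperforest (DE \<union> insert T \<D>) \<kappa>" by metis
      moreover have "insert T \<D> \<in> Pow (triangles_in V)" using T D(1) by blast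
      ultimately have "insert T \<D> \<in> ?F" by blast
      then have "\<D> = insert T \<D>" using D(2) by blast
      then show False using T by blast
    qed
  qed
qed

end

section \<open>Extending a colouring greedily\<close>

locale list_graph = sparse_graph V0 E for V0 :: "'a set" and E :: "'a set set" +
  fixes L :: "'a \<Rightarrow> 'c set"
  assumes card_L: "v \<in> V0 \<Longrightarrow> card (L v) = 3"
    and L_one: "{x,y} \<in> E \<Longrightarrow> \<beta> \<in> L x \<inter> L y \<Longrightarrow> \<gamma> \<in> L x \<inter> L y \<Longrightarrow> \<beta> = \<gamma>"

text \<open>
The situation of the inductive step: \<open>X\<close> is the part that is coloured already, \<open>\<D>\<close> is the set of bundled
triangles, \<open>DE\<close> consists of the edges with the stronger constraint \<open>K\<close>, and \<open>items\<close> are all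
constraints: \<open>\<D>\<close> and the edges in no triangle of \<open>\<D>\<close>. By \<open>K_one\<close>, a colour of one end of an edge in
\<open>DE\<close> still excludes at most one colour of the other end.
\<close>

locale extension = list_graph V0 E L for V0 :: "'a set" and E and L :: "'a \<Rightarrow> 'c set" +
  fixes V X :: "'a set" and DE \<D> :: "'a set set" and K :: "'a \<Rightarrow> 'c \<Rightarrow> 'a \<Rightarrow> 'c \<Rightarrow> bool"
    and \<nu> :: "'a set \<Rightarrow> 'a" and items :: "'a set set"
  assumes V: "V \<subseteq> V0" and XV: "X \<subseteq> V"
    and DE: "DE \<subseteq> edges_in V" and \<D>: "\<D> \<subseteq> triangles_in V"
    and K_sym: "{x,y} \<in> DE \<Longrightarrow> K x \<alpha> y \<beta> \<Longrightarrow> K y \<beta> x \<alpha>"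
    and K_refl: "{x,y} \<in> DE \<Longrightarrow> K x \<alpha> y \<alpha>"
    and K_one: "{x,y} \<in> DE \<Longrightarrow> \<alpha> \<in> L x \<Longrightarrow> \<beta> \<in> L y \<Longrightarrow> \<gamma> \<in> L y \<Longrightarrow> K x \<alpha> y \<beta> \<Longrightarrow> K x \<alpha> y \<gamma> \<Longrightarrow> \<beta> = \<gamma>"
    and items: "DE \<subseteq> items" "\<D> \<subseteq> items" "items \<subseteq> edges_in V \<union> \<D>"
      "\<And>e. e \<in> edges_in V \<Longrightarrow> e \<in> items \<or> (\<exists>T\<in>\<D>. e \<subseteq> T)"
    and pays: "u \<in> V - X \<Longrightarrow> card {i\<in>items. u \<in> i \<and> \<not> (i \<subseteq> V - X \<and> \<nu> i = u)} \<le> 2"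
begin

text \<open>
Only a constraint disjoint from \<open>X\<close> has an exempt vertex: any other one has been begun by its vertices in \<open>X\<close>.
\<close>

definition owned :: "'a set \<Rightarrow> 'a \<Rightarrow> bool" where
  "owned i u \<longleftrightarrow> i \<subseteq> V - X \<and> \<nu> i = u"

text \<open>
The edges that are settled by their payer regardless of any order, by avoiding the common colour of both lists.
\<close>

definition static :: "'a set set" where "static = items - DE - \<D>"

text \<open>
A safe partial colouring of \<open>W\<close> has met all its obligations so far. For a triangle with two coloured
vertices, this includes that they do not use up two colours of the third vertex.
\<close>

definition safe :: "('a \<Rightarrow> 'c) \<Rightarrow> 'a set \<Rightarrow> bool" where
  "safe \<phi> W \<longleftrightarrow>
     (\<forall>v\<in>W. \<phi> v \<in> L v) \<and>
     (\<forall>x y. {x,y} \<in> edges_in X \<longrightarrow> \<phi> x \<noteq> \<phi> y) \<and>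
     (\<forall>x y. {x,y} \<in> static \<longrightarrow> x \<in> W - X \<longrightarrow> \<not> owned {x,y} x \<longrightarrow> \<phi> x \<notin> L y) \<and>
     (\<forall>x y. {x,y} \<in> DE \<longrightarrow> x \<in> W \<longrightarrow> y \<in> W \<longrightarrow> \<not> K x (\<phi> x) y (\<phi> y)) \<and>
     (\<forall>T\<in>\<D>. \<forall>p\<in>T \<inter> W. \<forall>q\<in>T \<inter> W. p \<noteq> q \<longrightarrow>
        \<phi> p \<noteq> \<phi> q \<and> (\<forall>v\<in>T - W. \<not> (\<phi> p \<in> L v \<and> \<phi> q \<in> L v)))"

lemma edge_ne: "{x,y} \<in> E \<Longrightarrow> x \<noteq> y"
  using edge[of "{x,y}"] by auto

lemma tri_pair: "T \<in> \<D> \<Longrightarrow> p \<in> T \<Longrightarrow> q \<in> T \<Longrightarrow> p \<noteq> q \<Longrightarrow> {p,q} \<in> E"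
  using \<D> unfolding triangles_def by blast

lemma \<D>_card: "T \<in> \<D> \<Longrightarrow> card T = 3" using \<D> tri_card by blast

text \<open>
The colours \<open>\<beta>\<close> of the vertex \<open>u\<close> that the constraint \<open>i\<close> excludes when \<open>u\<close> is the next vertex after \<open>W\<close>.
\<close>

definition bad :: "('a \<Rightarrow> 'c) \<Rightarrow> 'a set \<Rightarrow> 'a \<Rightarrow> 'a set \<Rightarrow> 'c \<Rightarrow> bool" where
  "bad \<phi> W u i \<beta> \<longleftrightarrow>
     (i \<in> static \<and> (\<exists>y. i = {u,y} \<and> \<beta> \<in> L y)) \<or>
     (i \<in> DE \<and> (\<exists>w\<in>W. i = {u,w} \<and> K w (\<phi> w) u \<beta>)) \<or>
     (i \<in> \<D> \<and> (\<exists>p\<in>i \<inter> W. \<phi> p = \<beta> \<or> (\<exists>q\<in>i - W - {u}. \<phi> p \<in> L q \<and> \<beta> \<in> L q)))"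

lemma static_edge: "i \<in> static \<Longrightarrow> i \<in> edges_in V" using items(3) unfolding static_def by blast

lemma DE_not_\<D>: "i \<in> DE \<Longrightarrow> i \<notin> \<D>"
proof
  assume "i \<in> DE" "i \<in> \<D>"
  then have "card i = 2" "card i = 3" using DE edge \<D>_card by blast+
  then show False by simp
qed

text \<open>
For a triangle with one coloured vertex \<open>p\<close> and one uncoloured further vertex \<open>q\<close>, the excluded colours are
that of \<open>p\<close> and, if that one is in \<open>L q\<close>, the common colour of \<open>L u\<close> and \<open>L q\<close>; if both are in \<open>L u\<close>, then
they are equal. If two vertices are coloured already, safety says that only one of their colours is in \<open>L u\<close>.
\<close>

lemma bad_one:
  assumes safe: "safe \<phi> W" and u: "u \<in> V" "u \<notin> W" "u \<in> i"
    and b: "\<beta> \<in> L u" "\<gamma> \<in> L u" "bad \<phi> W u i \<beta>" "bad \<phi> W u i \<gamma>"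
  shows "\<beta> = \<gamma>"
proof -
  consider "i \<in> static" "i \<notin> DE" "i \<notin> \<D>" | "i \<in> DE" "i \<notin> static" "i \<notin> \<D>" | "i \<in> \<D>" "i \<notin> static" "i \<notin> DE"
    using b(3) DE_not_\<D> unfolding bad_def static_def by blast
  then show ?thesis
  proof cases
    case 1
    obtain y where y: "i = {u,y}" "\<beta> \<in> L y" using b(3) 1 unfolding bad_def by blast
    obtain z where z: "i = {u,z}" "\<gamma> \<in> L z" using b(4) 1 unfolding bad_def by blast
    have "z = y" using y(1) z(1) by (metis doubleton_eq_iff)
    moreover have "{u,y} \<in> E" using static_edge[OF 1(1)] y(1) by simp
    ultimately show ?thesis using L_one[of u y] b(1,2) y(2) z(2) by blast
  next
    case 2
    obtain y where y: "y \<in> W" "i = {u,y}" "K y (\<phi> y) u \<beta>" using b(3) 2 unfolding bad_def by blast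
    obtain z where z: "z \<in> W" "i = {u,z}" "K z (\<phi> z) u \<gamma>" using b(4) 2 unfolding bad_def by blast
    have "z = y" using y(2) z(2) by (metis doubleton_eq_iff)
    moreover have "{y,u} \<in> DE" using 2(1) y(2) by (simp add: insert_commute)
    moreover have "\<phi> y \<in> L y" using safe y(1) unfolding safe_def by blast
    ultimately show ?thesis using K_one[of y u "\<phi> y" \<beta> \<gamma>] b(1,2) y(3) z(3) by blast
  next
    case 3
    obtain p where p: "p \<in> i" "p \<in> W" "\<phi> p = \<beta> \<or> (\<exists>q\<in>i - W - {u}. \<phi> p \<in> L q \<and> \<beta> \<in> L q)"
      using b(3) 3 unfolding bad_def by blast
    obtain p' where p': "p' \<in> i" "p' \<in> W" "\<phi> p' = \<gamma> \<or> (\<exists>q\<in>i - W - {u}. \<phi> p' \<in> L q \<and> \<gamma> \<in> L q)"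
      using b(4) 3 unfolding bad_def by blast
    have pu: "p \<noteq> u" "p' \<noteq> u" using p(2) p'(2) u(2) by blast+
    show ?thesis
    proof (cases "p = p'")
      case False
      then have "i = {u,p,p'}" using card3_eq[OF \<D>_card[OF 3(1)] u(3) p(1) p'(1)] pu by blast
      then have "i - W - {u} = {}" using p(2) p'(2) by blast
      then have "\<phi> p = \<beta>" "\<phi> p' = \<gamma>" using p(3) p'(3) by blast+
      moreover have "\<not> (\<phi> p \<in> L u \<and> \<phi> p' \<in> L u)"
        using safe 3(1) p(1,2) p'(1,2) False u(2,3) unfolding safe_def by blast
      ultimately show ?thesis using b(1,2) by blast
    next
      case True
      have uq: "q = q'" if "q \<in> i - W - {u}" "q' \<in> i - W - {u}" for q q'
      proof -
        have "i = {u,p,q}" by (rule card3_eq[OF \<D>_card[OF 3(1)] u(3) p(1)]) (use that p(2) pu in blast)+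
        then show ?thesis using that(2) p(2) by blast
      qed
      have both: "\<beta> = \<gamma>" if q: "q \<in> i - W - {u}" "\<beta> \<in> L q" "\<gamma> \<in> L q" for q
      proof -
        have "{u,q} \<in> E" by (rule tri_pair[OF 3(1) u(3)]) (use q in blast)+
        then show ?thesis using L_one[of u q] q b(1,2) by blast
      qed
      show ?thesis using p(3) p'(3) uq both unfolding True[symmetric] by blast
    qed
  qed
qed

text \<open>
The vertex \<open>u\<close> has three colours and pays for at most two constraints, each of which excludes one colour.
A forest constraint for which \<open>u\<close> does not pay has no other coloured vertex yet.
\<close>

lemma colour_next:
  assumes safe: "safe \<phi> W" and W: "X \<subseteq> W" "W \<subseteq> V" and u: "u \<in> V - W"
    and own: "\<And>i. i \<in> DE \<union> \<D> \<Longrightarrow> u \<in> i \<Longrightarrow> owned i u \<Longrightarrow> i \<inter> W = {}"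
  shows "\<exists>c. safe (\<phi>(u := c)) (insert u W)"
proof -
  define P where "P = {i\<in>items. u \<in> i \<and> \<not> owned i u}"
  have uX: "u \<in> V - X" using u W by blast
  have finP: "finite P"
  proof -
    have "finite (edges_in V \<union> triangles_in V)" using finite_ind[OF V] by simp
    then show ?thesis using items(3) \<D> unfolding P_def by (elim rev_finite_subset) blast
  qed
  have "card P \<le> 2" using pays[OF uX] unfolding P_def owned_def .
  define B where "B i = {\<beta>\<in>L u. bad \<phi> W u i \<beta>}" for i
  have L3: "card (L u) = 3" using card_L uX V by blast
  then have finL: "finite (L u)" using card.infinite by fastforce
  have "card (B i) \<le> 1" if "i \<in> P" for i
  proof -
    have "finite (B i)" using finL unfolding B_def by simp
    moreover have "\<forall>\<beta>\<in>B i. \<forall>\<gamma>\<in>B i. \<beta> = \<gamma>"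
      using bad_one[OF safe] u that unfolding B_def P_def by blast
    ultimately show ?thesis by (simp add: card_le_Suc0_iff_eq)
  qed
  then have "(\<Sum>i\<in>P. card (B i)) \<le> card P" using sum_bounded_above[of P "\<lambda>i. card (B i)" 1] by simp
  then have "card (\<Union>i\<in>P. B i) \<le> 2" using card_UN_le[OF finP, of B] \<open>card P \<le> 2\<close> by linarith
  then have "\<not> L u \<subseteq> (\<Union>i\<in>P. B i)"
    using L3 card_mono[of "\<Union>i\<in>P. B i" "L u"] finP finL unfolding B_def by fastforce
  then obtain c where c: "c \<in> L u" "\<And>i. i \<in> P \<Longrightarrow> \<not> bad \<phi> W u i c" unfolding B_def by blast
  have uW: "u \<notin> W" using u by blast
  let ?\<phi> = "\<phi>(u := c)"
  have same: "?\<phi> v = \<phi> v" if "v \<noteq> u" for v using that by simp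
  have new: "?\<phi> u = c" by simp
  have paid: "i \<in> P" if "i \<in> DE \<union> \<D>" "u \<in> i" "i \<inter> W \<noteq> {}" for i
    using own[OF that(1,2)] that items(1,2) unfolding P_def by blast
  have "safe ?\<phi> (insert u W)" unfolding safe_def
  proof (intro conjI allI impI ballI)
    fix v assume "v \<in> insert u W" then show "?\<phi> v \<in> L v" using c(1) safe unfolding safe_def by (cases "v = u") auto
  next
    fix x y assume xy: "{x,y} \<in> edges_in X"
    then have "x \<noteq> u" "y \<noteq> u" using uX by blast+
    then show "?\<phi> x \<noteq> ?\<phi> y" using safe xy unfolding safe_def by simp
  next
    fix x y assume xy: "{x,y} \<in> static" "x \<in> insert u W - X" "\<not> owned {x,y} x"
    show "?\<phi> x \<notin> L y"
    proof (cases "x = u")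
      case True
      then have "{x,y} \<in> P" using xy unfolding P_def static_def by blast
      then have "\<not> bad \<phi> W u {x,y} c" by (rule c(2))
      then show ?thesis using xy(1) True unfolding bad_def by auto
    next
      case False
      then show ?thesis using xy safe unfolding safe_def by simp
    qed
  next
    fix x y assume xy: "{x,y} \<in> DE" "x \<in> insert u W" "y \<in> insert u W"
    have ne: "x \<noteq> y" using xy(1) DE edge_ne by blast
    have yx: "{y,x} \<in> DE" using xy(1) by (simp add: insert_commute)
    have key: "\<not> K w (\<phi> w) u c" if "w \<in> W" "{u,w} \<in> DE" for w
    proof -
      have "{u,w} \<in> P" using paid[of "{u,w}"] that by blast
      then have "\<not> bad \<phi> W u {u,w} c" by (rule c(2))
      then show ?thesis using that unfolding bad_def by blast
    qed
    show "\<not> K x (?\<phi> x) y (?\<phi> y)"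
    proof (cases "x = u")
      case True
      then have "y \<in> W" "y \<noteq> u" using xy ne by blast+
      then have "\<not> K y (\<phi> y) u c" using key xy(1) True by blast
      then have "\<not> K u c y (\<phi> y)" using K_sym[of u y c "\<phi> y"] xy(1) True by blast
      then show ?thesis using True \<open>y \<noteq> u\<close> by simp
    next
      case False
      then have x: "x \<in> W" using xy(2) by blast
      show ?thesis
      proof (cases "y = u")
        case True
        then show ?thesis using key[OF x] yx False by simp
      next
        case yF: False
        then show ?thesis using safe xy False unfolding safe_def by simp
      qed
    qed
  next
    fix T p q assume T: "T \<in> \<D>" "p \<in> T \<inter> insert u W" "q \<in> T \<inter> insert u W" "p \<noteq> q"
    have key: "\<phi> w \<noteq> c \<and> (\<forall>v\<in>T - insert u W. \<not> (\<phi> w \<in> L v \<and> c \<in> L v))" if "w \<in> T \<inter> W" "u \<in> T" for w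
    proof -
      have "T \<in> P" using paid[of T] that T(1) by blast
      then have "\<not> bad \<phi> W u T c" by (rule c(2))
      then show ?thesis using that T(1) unfolding bad_def by blast
    qed
    have "?\<phi> p \<noteq> ?\<phi> q \<and> (\<forall>v\<in>T - insert u W. \<not> (?\<phi> p \<in> L v \<and> ?\<phi> q \<in> L v))"
    proof (cases "p = u")
      case True
      then have "q \<in> T \<inter> W" "u \<in> T" "q \<noteq> u" using T by blast+
      then show ?thesis using key[of q] True by auto
    next
      case False
      then have p: "p \<in> T \<inter> W" using T(2) by blast
      show ?thesis
      proof (cases "q = u")
        case True
        then have "u \<in> T" using T by blast
        then show ?thesis using key[OF p] True False by auto
      next
        case qF: False
        then have "q \<in> T \<inter> W" using T(3) by blast
        then have "\<phi> p \<noteq> \<phi> q \<and> (\<forall>v\<in>T - W. \<not> (\<phi> p \<in> L v \<and> \<phi> q \<in> L v))"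
          using safe T(1,4) p unfolding safe_def by blast
        then show ?thesis using False qF by simp
      qed
    qed
    then show "?\<phi> p \<noteq> ?\<phi> q" "\<And>v. v \<in> T - insert u W \<Longrightarrow> \<not> (?\<phi> p \<in> L v \<and> ?\<phi> q \<in> L v)" by blast+
  qed
  then show ?thesis by blast
qed

text \<open>
Colouring in the order of \<open>r\<close> guarantees that the exempt vertex of a forest constraint is its first vertex.
\<close>

lemma colour_all:
  assumes rank: "\<And>i w. i \<in> DE \<union> \<D> \<Longrightarrow> i \<subseteq> V - X \<Longrightarrow> w \<in> i \<Longrightarrow> w \<noteq> \<nu> i \<Longrightarrow> r (\<nu> i) < (r w :: nat)"
    and W: "X \<subseteq> W" "W \<subseteq> V" "\<And>w v. w \<in> W - X \<Longrightarrow> v \<in> V - W \<Longrightarrow> r w \<le> r v" and safe: "safe \<phi> W"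
  shows "\<exists>\<phi>. safe \<phi> V"
  using W safe
proof (induction "card (V - W)" arbitrary: W \<phi>)
  case 0
  have "finite V" using V finV0 finite_subset by blast
  then have "V = W" using 0 by (simp add: subset_antisym)
  then show ?case using 0 by blast
next
  case (Suc n)
  have finV: "finite V" using V finV0 finite_subset by blast
  have "V - W \<noteq> {}" using Suc.hyps(2) by (metis card.empty nat.distinct(1))
  then obtain u where u: "u \<in> V - W" "\<And>v. v \<in> V - W \<Longrightarrow> r u \<le> r v"
    using ex_has_least_nat[of "\<lambda>v. v \<in> V - W" _ r] by blast
  have "i \<inter> W = {}" if i: "i \<in> DE \<union> \<D>" "u \<in> i" "owned i u" for i
  proof (rule equals0I)
    fix w assume w: "w \<in> i \<inter> W"
    have o: "i \<subseteq> V - X" "\<nu> i = u" using i(3) unfolding owned_def by blast+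
    have "w \<noteq> u" using w u(1) by blast
    then have "r u < r w" using rank[OF i(1) o(1), of w] w o(2) by blast
    moreover have "r w \<le> r u" using Suc.prems(3)[of w u] w o(1) u(1) by blast
    ultimately show False by simp
  qed
  then obtain c where c: "safe (\<phi>(u := c)) (insert u W)"
    using colour_next[OF Suc.prems(4,1,2) u(1)] by blast
  have "n = card (V - insert u W)"
  proof -
    have "V - insert u W = (V - W) - {u}" by blast
    then show ?thesis using Suc.hyps(2) u(1) finV by simp
  qed
  then show ?case
  proof (rule Suc.hyps(1)[OF _ _ _ _ c])
    show "X \<subseteq> insert u W" "insert u W \<subseteq> V" using Suc.prems(1,2) u(1) by blast+
    fix w v assume wv: "w \<in> insert u W - X" "v \<in> V - insert u W"
    show "r w \<le> r v"
    proof (cases "w = u")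
      case True then show ?thesis using u(2)[of v] wv(2) by blast
    next
      case False then show ?thesis using Suc.prems(3)[of w v] wv by blast
    qed
  qed
qed

text \<open>
A static edge that is not inside \<open>X\<close> has an end that pays for it: one of its ends is not exempt, or it is
the only end outside \<open>X\<close>.
\<close>

lemma safe_proper:
  assumes safe: "safe \<phi> V" and xy: "{x,y} \<in> edges_in V"
  shows "\<phi> x \<noteq> \<phi> y"
proof -
  have ne: "x \<noteq> y" using xy edge_ne by blast
  have V': "x \<in> V" "y \<in> V" using xy by blast+
  have L: "\<phi> x \<in> L x" "\<phi> y \<in> L y" using safe V' unfolding safe_def by blast+
  consider (T) T where "T \<in> \<D>" "{x,y} \<subseteq> T" | (DE) "{x,y} \<in> DE" | (X) "{x,y} \<in> edges_in X"
    | (st) "{x,y} \<in> static" "\<not> {x,y} \<subseteq> X"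
  proof -
    have "{x,y} \<in> \<D> \<Longrightarrow> \<exists>T\<in>\<D>. {x,y} \<subseteq> T" by blast
    then show thesis using items(4)[OF xy] that xy unfolding static_def by blast
  qed
  then show ?thesis
  proof cases
    case T
    note tri = safe[unfolded safe_def, THEN conjunct2, THEN conjunct2, THEN conjunct2, THEN conjunct2]
    have "x \<in> T \<inter> V" "y \<in> T \<inter> V" using T(2) V' by blast+
    from tri[rule_format, OF T(1) this ne] show ?thesis by simp
  next
    case DE
    note diff = safe[unfolded safe_def, THEN conjunct2, THEN conjunct2, THEN conjunct2, THEN conjunct1]
    have "\<not> K x (\<phi> x) y (\<phi> y)" by (rule diff[rule_format, OF DE V'])
    then show ?thesis using K_refl[OF DE, of "\<phi> x"] by auto
  next
    case X then show ?thesis using safe unfolding safe_def by simp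
  next
    case st
    have yx: "{y,x} = {x,y}" by blast
    note sta = safe[unfolded safe_def, THEN conjunct2, THEN conjunct2, THEN conjunct1]
    have "(x \<notin> X \<and> \<not> owned {x,y} x) \<or> (y \<notin> X \<and> \<not> owned {x,y} y)"
      using st(2) ne unfolding owned_def by (cases "\<nu> {x,y} = x") auto
    then have "\<phi> x \<notin> L y \<or> \<phi> y \<notin> L x"
    proof
      assume "x \<notin> X \<and> \<not> owned {x,y} x"
      then have "\<phi> x \<notin> L y" using sta[rule_format, OF st(1)] V'(1) by simp
      then show ?thesis ..
    next
      assume "y \<notin> X \<and> \<not> owned {x,y} y"
      then have "\<not> owned {y,x} y" "{y,x} \<in> static" "y \<in> V - X" using st(1) V' unfolding yx by simp_all
      then have "\<phi> y \<notin> L x" using sta[rule_format, of y x] by simp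
      then show ?thesis ..
    qed
    then show ?thesis
    proof
      assume "\<phi> x \<notin> L y" then show ?thesis using L(2) by auto
    next
      assume "\<phi> y \<notin> L x" then show ?thesis using L(1) by auto
    qed
  qed
qed

end

section \<open>List colouring of sparse graphs\<close>

text \<open>
Bundling a triangle replaces three edges, of cost one each, by one constraint of cost two.
\<close>

lemma (in sparse_graph) edges_outside_triangles:
  assumes V: "V \<subseteq> V0" and \<D>: "\<D> \<subseteq> triangles_in V"
  shows "card {e\<in>edges_in V. \<forall>T\<in>\<D>. \<not> e \<subseteq> T} + 3 * card \<D> \<le> card (edges_in V)"
proof -
  note fin = finite_ind[OF V]
  have finD: "finite \<D>" using finite_subset[OF \<D> fin(2)] .
  define In where "In T = {e. e \<subseteq> T \<and> card e = 2}" for T :: "'a set"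
  have tri: "T \<in> triangles E" "T \<subseteq> V" if "T \<in> \<D>" for T using \<D> that by blast+
  have InE: "In T \<subseteq> edges_in V" if "T \<in> \<D>" for T
    using tri_edge[OF tri(1)[OF that]] tri(2)[OF that] unfolding In_def by blast
  have cIn: "card (In T) = 3" if "T \<in> \<D>" for T
  proof -
    have c: "card T = 3" by (rule tri_card[OF tri(1)[OF that]])
    then have "finite T" using card.infinite by fastforce
    then show ?thesis unfolding In_def using n_subsets[of T 2] c by (simp add: numeral_eq_Suc)
  qed
  have "card (\<Union>T\<in>\<D>. In T) = (\<Sum>T\<in>\<D>. card (In T))"
  proof (rule card_UN_disjoint[OF finD])
    show "\<forall>T\<in>\<D>. finite (In T)" using finite_subset[OF InE fin(1)] by blast
    show "\<forall>T\<in>\<D>. \<forall>T'\<in>\<D>. T \<noteq> T' \<longrightarrow> In T \<inter> In T' = {}"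
      using tri_unique[OF tri(1) tri(1)] unfolding In_def by blast
  qed
  also have "\<dots> = 3 * card \<D>" using cIn by simp
  finally have 1: "card (\<Union>T\<in>\<D>. In T) = 3 * card \<D>" .
  have U: "(\<Union>T\<in>\<D>. In T) \<subseteq> edges_in V" using InE by (rule UN_least)
  let ?R = "{e\<in>edges_in V. \<forall>T\<in>\<D>. \<not> e \<subseteq> T}"
  have "card ?R + card (\<Union>T\<in>\<D>. In T) = card (?R \<union> (\<Union>T\<in>\<D>. In T))"
  proof (rule card_Un_disjoint[symmetric])
    show "finite ?R" by (rule rev_finite_subset[OF fin(1)]) blast
    show "finite (\<Union>T\<in>\<D>. In T)" using finite_subset[OF U fin(1)] .
    show "?R \<inter> (\<Union>T\<in>\<D>. In T) = {}" unfolding In_def by blast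
  qed
  also have "\<dots> \<le> card (edges_in V)" by (rule card_mono[OF fin(1)]) (use U in blast)
  finally show ?thesis using 1 by simp
qed

context list_graph begin

text \<open>
In the inductive step, a bundled triangle with exactly two vertices in \<open>X\<close> becomes a constraint \<open>K'\<close> on these two
vertices: they must be different and must not use two colours of the third vertex \<open>v\<close>. This
excludes at most one colour, since the lists of adjacent vertices share at most one. The new pairs
together with the old ones again form a forest, by \<open>hyperforest_restrict\<close>, and none of them is in a triangle
inside \<open>X\<close>, because triangles are edge-disjoint.
\<close>

theorem colouring_with_forest:
  assumes "V \<subseteq> V0" and "hyperforest DE \<kappa>" and "DE \<subseteq> edges_in V"
    and "\<And>e T. e \<in> DE \<Longrightarrow> T \<in> triangles_in V \<Longrightarrow> \<not> e \<subseteq> T"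
    and "\<And>x y \<alpha> \<beta>. {x,y} \<in> DE \<Longrightarrow> K x \<alpha> y \<beta> \<Longrightarrow> K y \<beta> x \<alpha>"
    and "\<And>x y \<alpha>. {x,y} \<in> DE \<Longrightarrow> K x \<alpha> y \<alpha>"
    and "\<And>x y \<alpha> \<beta> \<gamma>. {x,y} \<in> DE \<Longrightarrow> \<alpha> \<in> L x \<Longrightarrow> \<beta> \<in> L y \<Longrightarrow> \<gamma> \<in> L y \<Longrightarrow>
       K x \<alpha> y \<beta> \<Longrightarrow> K x \<alpha> y \<gamma> \<Longrightarrow> \<beta> = \<gamma>"
  shows "\<exists>\<phi>. (\<forall>v\<in>V. \<phi> v \<in> L v) \<and> (\<forall>x y. {x,y} \<in> edges_in V \<longrightarrow> \<phi> x \<noteq> \<phi> y) \<and>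
     (\<forall>x y. {x,y} \<in> DE \<longrightarrow> \<not> K x (\<phi> x) y (\<phi> y))"
  using assms
proof (induction "card V" arbitrary: V DE \<kappa> K rule: less_induct)
  case less
  note V = less.prems(1) and forest0 = less.prems(2) and DE = less.prems(3) and noT = less.prems(4)
    and K_sym = less.prems(5) and K_refl = less.prems(6) and K_one = less.prems(7)
  have finV: "finite V" using V finV0 finite_subset by blast
  show ?case
  proof (cases "V = {}")
    case True
    have "edges_in V = {}" using edge True by force
    then show ?thesis using DE True by auto
  next
    case ne: False
    obtain \<D> \<kappa>' where D: "\<D> \<subseteq> triangles_in V" and forest: "hyperforest (DE \<union> \<D>) \<kappa>'"
      and max: "\<And>T. T \<in> triangles_in V - \<D> \<Longrightarrow> \<not> inj_on \<kappa>' T"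
      using maximal_forest[OF V forest0] by blast
    (* Constraints: the bundled triangles and the remaining edges R, of total cost at most 2 |V|. *)
    define R where "R = {e\<in>edges_in V. \<forall>T\<in>\<D>. \<not> e \<subseteq> T}"
    define items where "items = \<D> \<union> R"
    have finR: "finite R" "finite \<D>" unfolding R_def
      using finite_ind[OF V] finite_subset[OF D] by (auto intro: rev_finite_subset)
    have c3: "card T = 3" if "T \<in> \<D>" for T using that D tri_card by blast
    have c2: "card e = 2" if "e \<in> E" for e using that edge by blast
    have items_V: "i \<subseteq> V \<and> i \<noteq> {}" if "i \<in> items" for i
      using that D c3[of i] c2[of i] unfolding items_def R_def by auto
    have "(\<Sum>i\<in>items. card i - 1) = 2 * card \<D> + card R"
    proof -
      have "\<D> \<inter> R = {}" unfolding R_def by blast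
      then have "(\<Sum>i\<in>items. card i - 1) = (\<Sum>i\<in>\<D>. card i - 1) + (\<Sum>i\<in>R. card i - 1)"
        unfolding items_def using finR by (simp add: sum.union_disjoint)
      moreover have "(\<Sum>i\<in>\<D>. card i - 1) = 2 * card \<D>" using c3 by simp
      moreover have "(\<Sum>i\<in>R. card i - 1) = card R" using c2 unfolding R_def by simp
      ultimately show ?thesis by simp
    qed
    moreover have "card R + 3 * card \<D> \<le> card (edges_in V)"
      unfolding R_def by (rule edges_outside_triangles[OF V D])
    moreover have "card (edges_in V) \<le> 2 * card V + card \<D>"
      by (rule edge_bound[OF V ne forest DE noT D max])
    ultimately have count: "(\<Sum>i\<in>items. card i - 1) \<le> 2 * card V" by linarith
    have "finite items" unfolding items_def using finR by simp
    from orientation[OF finV ne this items_V count]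
    obtain X \<nu> where X: "X \<subset> V" and nu: "\<And>i. i \<in> items \<Longrightarrow> \<nu> i \<in> i"
      and pays: "\<And>u. u \<in> V - X \<Longrightarrow> card {i\<in>items. u \<in> i \<and> \<not> (i \<subseteq> V - X \<and> \<nu> i = u)} \<le> 2" by blast
    have XV0: "X \<subseteq> V0" using X V by blast
    have DE_R: "DE \<subseteq> R" unfolding R_def using DE noT D by blast
    interpret e: extension V0 E L V X DE \<D> K \<nu> items
    proof
      show "X \<subseteq> V" using X by blast
      show "DE \<subseteq> items" "\<D> \<subseteq> items" "items \<subseteq> edges_in V \<union> \<D>" using DE_R unfolding items_def R_def by blast+
      show "\<And>e. e \<in> edges_in V \<Longrightarrow> e \<in> items \<or> (\<exists>T\<in>\<D>. e \<subseteq> T)" unfolding items_def R_def by blast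
      show "{x,y} \<in> DE \<Longrightarrow> K x \<alpha> y \<beta> \<Longrightarrow> K y \<beta> x \<alpha>" for x y \<alpha> \<beta> by (rule K_sym)
      show "{x,y} \<in> DE \<Longrightarrow> K x \<alpha> y \<alpha>" for x y \<alpha> by (rule K_refl)
      show "{x,y} \<in> DE \<Longrightarrow> \<alpha> \<in> L x \<Longrightarrow> \<beta> \<in> L y \<Longrightarrow> \<gamma> \<in> L y \<Longrightarrow> K x \<alpha> y \<beta> \<Longrightarrow> K x \<alpha> y \<gamma> \<Longrightarrow> \<beta> = \<gamma>"
        for x y \<alpha> \<beta> \<gamma> by (rule K_one)
      show "u \<in> V - X \<Longrightarrow> card {i\<in>items. u \<in> i \<and> \<not> (i \<subseteq> V - X \<and> \<nu> i = u)} \<le> 2" for u by (rule pays)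
    qed (fact V DE D)+
    define DE' where "DE' = {R. \<exists>S\<in>DE \<union> \<D>. R = S \<inter> X \<and> card R = 2}"
    define K' where "K' x \<alpha> y \<beta> \<longleftrightarrow> (if {x,y} \<in> DE then K x \<alpha> y \<beta>
       else \<exists>v. {x,y,v} \<in> \<D> \<and> v \<notin> X \<and> (\<alpha> = \<beta> \<or> \<alpha> \<in> L v \<and> \<beta> \<in> L v))" for x \<alpha> y \<beta>
    have DE'_cases: "e \<in> DE \<or> (\<exists>T\<in>\<D>. e = T \<inter> X)" "card e = 2" "e \<subseteq> X" if e: "e \<in> DE'" for e
    proof -
      obtain S where S: "S \<in> DE \<union> \<D>" "e = S \<inter> X" "card e = 2" using e unfolding DE'_def by blast
      show "card e = 2" "e \<subseteq> X" using S by blast+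
      show "e \<in> DE \<or> (\<exists>T\<in>\<D>. e = T \<inter> X)"
      proof (cases "S \<in> DE")
        case True
        then have cS: "card S = 2" using DE c2 by blast
        then have "finite S" using card.infinite by fastforce
        then have "e = S" using S(2,3) cS by (intro card_subset_eq) auto
        then show ?thesis using True by blast
      next
        case False then show ?thesis using S by blast
      qed
    qed
    have third: "\<exists>v. {x,y,v} \<in> \<D> \<and> v \<notin> X \<and> x \<noteq> v \<and> y \<noteq> v \<and> {x,y,v} \<inter> X = {x,y}"
      if e: "{x,y} \<in> DE'" "{x,y} \<notin> DE" for x y
    proof -
      obtain T where T: "T \<in> \<D>" "{x,y} = T \<inter> X" using DE'_cases(1)[OF e(1)] e(2) by blast
      have xy: "x \<noteq> y" using DE'_cases(2)[OF e(1)] by auto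
      have "T \<noteq> {x,y}" using c3[OF T(1)] xy by auto
      then obtain v where v: "v \<in> T" "v \<notin> {x,y}" using T(2) by blast
      have "T = {x,y,v}" by (rule card3_eq[OF c3[OF T(1)]]) (use T(2) v xy in blast)+
      then show ?thesis using T v by blast
    qed
    have DE'_ind: "DE' \<subseteq> edges_in X"
    proof
      fix e assume e: "e \<in> DE'"
      have "e \<in> E"
      proof (cases "e \<in> DE")
        case True then show ?thesis using DE by blast
      next
        case False
        then obtain T where "T \<in> \<D>" "e = T \<inter> X" using DE'_cases(1)[OF e] by blast
        then show ?thesis using tri_edge[of T E e] D DE'_cases(2)[OF e] by blast
      qed
      then show "e \<in> edges_in X" using DE'_cases(3)[OF e] by blast
    qed
    have K'_DE: "K' x \<alpha> y \<beta> = K x \<alpha> y \<beta>" if "{x,y} \<in> DE" for x \<alpha> y \<beta> unfolding K'_def using that by simp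
    have K'_tri: "K' x \<alpha> y \<beta> \<longleftrightarrow> (\<exists>v. {x,y,v} \<in> \<D> \<and> v \<notin> X \<and> (\<alpha> = \<beta> \<or> \<alpha> \<in> L v \<and> \<beta> \<in> L v))" 
      if "{x,y} \<notin> DE" for x \<alpha> y \<beta> unfolding K'_def using that by simp
    obtain \<kappa>'' where forest'': "hyperforest DE' \<kappa>''"
      using hyperforest_restrict[OF forest, of X] unfolding DE'_def by blast
    have "\<exists>\<phi>. (\<forall>v\<in>X. \<phi> v \<in> L v) \<and> (\<forall>x y. {x,y} \<in> edges_in X \<longrightarrow> \<phi> x \<noteq> \<phi> y) \<and>
     (\<forall>x y. {x,y} \<in> DE' \<longrightarrow> \<not> K' x (\<phi> x) y (\<phi> y))"
    proof (rule less.hyps[OF _ XV0 forest'' DE'_ind])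
      show "card X < card V" by (rule psubset_card_mono[OF finV X])
    next
      fix e T assume e: "e \<in> DE'" and T: "T \<in> triangles_in X"
      show "\<not> e \<subseteq> T"
      proof
        assume sub: "e \<subseteq> T"
        have "e \<notin> DE" using noT[of e T] T X sub by blast
        then obtain T' where T': "T' \<in> \<D>" "e = T' \<inter> X" using DE'_cases(1)[OF e] by blast
        have "T' = T" by (rule tri_unique[of _ _ e]) (use T T' D sub DE'_cases(2)[OF e] in blast)+
        then have "e = T'" using T T' by blast
        then show False using DE'_cases(2)[OF e] c3[OF T'(1)] by simp
      qed
    next
      fix x y \<alpha> \<beta> assume xy: "{x,y} \<in> DE'" "K' x \<alpha> y \<beta>"
      have c: "{y,x} = {x,y}" by blast
      show "K' y \<beta> x \<alpha>"
      proof (cases "{x,y} \<in> DE")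
        case True
        then have "K y \<beta> x \<alpha>" using K_sym[OF True] xy(2) K'_DE by blast
        then show ?thesis using K'_DE[of y x] True c by simp
      next
        case False
        then obtain v where v: "{x,y,v} \<in> \<D>" "v \<notin> X" "\<alpha> = \<beta> \<or> \<alpha> \<in> L v \<and> \<beta> \<in> L v" using xy(2) K'_tri by blast
        have "{y,x,v} = {x,y,v}" by blast
        then show ?thesis using v K'_tri[of y x \<beta> \<alpha>] False c by metis
      qed
    next
      fix x y \<alpha> assume xy: "{x,y} \<in> DE'"
      show "K' x \<alpha> y \<alpha>"
      proof (cases "{x,y} \<in> DE")
        case True then show ?thesis using K_refl K'_DE by blast
      next
        case False then show ?thesis using third[OF xy False] K'_tri by blast
      qed
    next
      fix x y \<alpha> \<beta> \<gamma> assume xy: "{x,y} \<in> DE'" and L: "\<alpha> \<in> L x" "\<beta> \<in> L y" "\<gamma> \<in> L y"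
        and K: "K' x \<alpha> y \<beta>" "K' x \<alpha> y \<gamma>"
      show "\<beta> = \<gamma>"
      proof (cases "{x,y} \<in> DE")
        case True then show ?thesis using K_one[OF True L] K K'_DE by blast
      next
        case False
        obtain v where v: "{x,y,v} \<in> \<D>" "v \<notin> X" "\<alpha> = \<beta> \<or> \<alpha> \<in> L v \<and> \<beta> \<in> L v" using K(1) K'_tri[OF False] by blast
        obtain w where w: "{x,y,w} \<in> \<D>" "w \<notin> X" "\<alpha> = \<gamma> \<or> \<alpha> \<in> L w \<and> \<gamma> \<in> L w" using K(2) K'_tri[OF False] by blast
        have tri: "{x,y,v} \<in> triangles E" "{x,y,w} \<in> triangles E" using v(1) w(1) D by blast+
        have "{x,y,v} = {x,y,w}" by (rule tri_unique[OF tri, of "{x,y}"]) (use DE'_cases(2)[OF xy] in blast)+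
        moreover have xyX: "x \<in> X" "y \<in> X" using DE'_cases(3)[OF xy] by blast+
        ultimately have "w \<in> {x,y,v}" by simp
        then have vw: "w = v" using w(2) xyX by auto
        have "v \<noteq> y" using v(2) xyX by blast
        then have "{v,y} \<in> E" using e.tri_pair[OF v(1), of v y] by blast
        then have one: "\<beta>' = \<gamma>'" if "\<beta>' \<in> L v \<inter> L y" "\<gamma>' \<in> L v \<inter> L y" for \<beta>' \<gamma>' using L_one that by blast
        show ?thesis using v(3) w(3) L(2,3) one unfolding vw by blast
      qed
    qed
    then obtain \<phi> where \<phi>: "\<And>v. v \<in> X \<Longrightarrow> \<phi> v \<in> L v" "\<And>x y. {x,y} \<in> edges_in X \<Longrightarrow> \<phi> x \<noteq> \<phi> y"
      "\<And>x y. {x,y} \<in> DE' \<Longrightarrow> \<not> K' x (\<phi> x) y (\<phi> y)" by blast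
    have "e.safe \<phi> X" unfolding e.safe_def
    proof (intro conjI allI impI ballI)
      fix v assume "v \<in> X" then show "\<phi> v \<in> L v" by (rule \<phi>(1))
    next
      fix x y assume "{x,y} \<in> edges_in X" then show "\<phi> x \<noteq> \<phi> y" by (rule \<phi>(2))
    next
      fix x y assume "x \<in> X - X" then show "\<phi> x \<notin> L y" by blast
    next
      fix x y assume xy: "{x,y} \<in> DE" "x \<in> X" "y \<in> X"
      have "card {x,y} = 2" using xy(1) DE c2 by blast
      moreover have "{x,y} = {x,y} \<inter> X" using xy by blast
      ultimately have "{x,y} \<in> DE'" unfolding DE'_def using xy(1) by blast
      then show "\<not> K x (\<phi> x) y (\<phi> y)" using \<phi>(3) K'_DE[OF xy(1)] by blast
    next
      fix T p q assume T: "T \<in> \<D>" "p \<in> T \<inter> X" "q \<in> T \<inter> X" "p \<noteq> q"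
      have "{p,q} \<in> E" by (rule e.tri_pair[OF T(1)]) (use T in blast)+
      then show "\<phi> p \<noteq> \<phi> q" using \<phi>(2)[of p q] T by blast
      fix v assume v: "v \<in> T - X"
      have Teq: "T = {p,q,v}" by (rule card3_eq[OF c3[OF T(1)]]) (use T v in blast)+
      have "T \<inter> X = {p,q}" using Teq T v by blast
      moreover have "card {p,q} = 2" using T(4) by simp
      ultimately have "{p,q} \<in> DE'" unfolding DE'_def using T(1) by blast
      then have nK: "\<not> K' p (\<phi> p) q (\<phi> q)" by (rule \<phi>(3))
      have "{p,q} \<notin> DE" using noT[of "{p,q}" T] T D by blast
      then show "\<not> (\<phi> p \<in> L v \<and> \<phi> q \<in> L v)" using nK K'_tri T(1) Teq v by blast
    qed
    moreover obtain r :: "'a \<Rightarrow> nat" where r: "\<And>S w. S \<in> DE \<union> \<D> \<Longrightarrow> w \<in> S \<Longrightarrow> w \<noteq> \<nu> S \<Longrightarrow> r (\<nu> S) < r w"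
      using hyperforest_rank[OF forest, of \<nu>] nu e.items(1,2) by blast
    ultimately obtain \<psi> where \<psi>: "e.safe \<psi> V" using e.colour_all[of r X \<phi>] X by blast
    have "\<forall>v\<in>V. \<psi> v \<in> L v" using \<psi> unfolding e.safe_def by (elim conjE)
    moreover have "\<forall>x y. {x,y} \<in> edges_in V \<longrightarrow> \<psi> x \<noteq> \<psi> y" using e.safe_proper[OF \<psi>] by blast
    moreover have "\<forall>x y. {x,y} \<in> DE \<longrightarrow> \<not> K x (\<psi> x) y (\<psi> y)"
    proof (intro allI impI)
      fix x y assume xy: "{x,y} \<in> DE"
      then have "x \<in> V" "y \<in> V" using DE by blast+
      then show "\<not> K x (\<psi> x) y (\<psi> y)"
        using \<psi>[unfolded e.safe_def, THEN conjunct2, THEN conjunct2, THEN conjunct2, THEN conjunct1, rule_format, OF xy] by blast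
    qed
    ultimately show ?thesis by blast
  qed
qed

corollary list_colouring:
  "\<exists>\<phi>. (\<forall>v\<in>V0. \<phi> v \<in> L v) \<and> (\<forall>x y. {x,y} \<in> E \<longrightarrow> \<phi> x \<noteq> \<phi> y)"
proof -
  obtain \<phi> where "\<forall>v\<in>V0. \<phi> v \<in> L v" "\<forall>x y. {x,y} \<in> edges_in V0 \<longrightarrow> \<phi> x \<noteq> \<phi> y"
    using colouring_with_forest[OF order_refl hyperforest.empty, of "\<lambda>_ _ _ _. False"] by blast
  moreover have "edges_in V0 = E" using edge by blast
  ultimately show ?thesis by auto
qed

end

section \<open>Plane drawings of digraphs\<close>

lemma no_four_cycle_tri_unique:
  assumes "no_four_cycle E" "T \<in> triangles E" "T' \<in> triangles E" "e \<subseteq> T" "e \<subseteq> T'" "card e = 2"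
  shows "T = T'"
proof (rule ccontr)
  assume ne: "T \<noteq> T'"
  obtain x y where e: "e = {x,y}" "x \<noteq> y" using assms(6) by (meson card_2_iff)
  have c: "card T = 3" "card T' = 3" using assms(2,3) tri_card by blast+
  have "T \<noteq> {x,y}" "T' \<noteq> {x,y}" using c e(2) by auto
  then obtain a b where ab: "a \<in> T" "a \<notin> {x,y}" "b \<in> T'" "b \<notin> {x,y}" using assms(4,5) unfolding e(1) by blast
  have "T = {x,y,a}" by (rule card3_eq[OF c(1)]) (use ab e assms(4) in blast)+
  moreover have "T' = {x,y,b}" by (rule card3_eq[OF c(2)]) (use ab e assms(5) in blast)+
  ultimately have "a \<noteq> b" using ne by blast
  have "{x,a} \<in> E" by (rule tri_edge[OF assms(2)]) (use ab e assms(4) in auto)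
  moreover have "{a,y} \<in> E" by (rule tri_edge[OF assms(2)]) (use ab e assms(4) in auto)
  moreover have "{y,b} \<in> E" by (rule tri_edge[OF assms(3)]) (use ab e assms(5) in auto)
  moreover have "{b,x} \<in> E" by (rule tri_edge[OF assms(3)]) (use ab e assms(5) in auto)
  moreover have "distinct [x,a,y,b]" using ab(2,4) e(2) \<open>a \<noteq> b\<close> by auto
  ultimately show False using assms(1) unfolding no_four_cycle_def by blast
qed

definition edge_sets :: "'a pair_pre_digraph \<Rightarrow> 'a set set" where
  "edge_sets G = {{x,y} | x y. (x,y) \<in> parcs G}"

lemma (in pair_graph) edge_sets_iff: "{x,y} \<in> edge_sets G \<longleftrightarrow> (x,y) \<in> parcs G"
  unfolding edge_sets_def using arcs_symmetric by (auto simp: doubleton_eq_iff)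

lemma (in pair_graph) edge_sets_no_four_cycle:
  assumes "\<not> (\<exists>p. pre_digraph.cycle (with_proj G) p \<and> length p = 4)"
  shows "no_four_cycle (edge_sets G)"
  unfolding no_four_cycle_def
proof (intro allI impI notI)
  fix a b c d :: 'a
  assume dist: "distinct [a,b,c,d]"
    and "{a,b} \<in> edge_sets G \<and> {b,c} \<in> edge_sets G \<and> {c,d} \<in> edge_sets G \<and> {d,a} \<in> edge_sets G"
  then have arcs: "(a,b) \<in> parcs G" "(b,c) \<in> parcs G" "(c,d) \<in> parcs G" "(d,a) \<in> parcs G"
    unfolding edge_sets_iff by simp_all
  let ?p = "[(a,b),(b,c),(c,d),(d,a)]"
  have "a \<in> pverts G" using arcs(1) in_arcsD1 by blast
  then have "awalk a ?p a" using arcs unfolding awalk_def by simp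
  then have "cycle ?p" unfolding cycle_def using dist by (intro exI[of _ a]) auto
  then show False using assms by force
qed

lemma (in pair_graph) plane_drawing_drawn:
  assumes "plane_drawing G pos curve"
  shows "drawn (pverts G) (edge_sets G) pos
     (\<lambda>e. \<Union>{path_image (curve (x,y)) | x y. (x,y) \<in> parcs G \<and> {x,y} = e})"
proof -
  let ?img = "\<lambda>e. \<Union>{path_image (curve (x,y)) | x y. (x,y) \<in> parcs G \<and> {x,y} = e}"
  have inj: "inj_on pos (pverts G)" using assms unfolding plane_drawing_def by simp
  have curve: "Path_Connected.arc (curve (x,y))" "pathstart (curve (x,y)) = pos x" "pathfinish (curve (x,y)) = pos y"
    "curve (y,x) = reversepath (curve (x,y))" "path_image (curve (x,y)) \<inter> pos ` pverts G = {pos x, pos y}"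
    if "(x,y) \<in> parcs G" for x y
    using assms that unfolding plane_drawing_def by fast+
  have disjoint: "path_image (curve (x,y)) \<inter> path_image (curve (u,v)) \<subseteq> pos ` ({x,y} \<inter> {u,v})"
    if "(x,y) \<in> parcs G" "(u,v) \<in> parcs G" "{x,y} \<noteq> {u,v}" for x y u v
    using assms that unfolding plane_drawing_def by fast
  have img: "?img {a,b} = path_image (curve (a,b))" if ab: "(a,b) \<in> parcs G" for a b
  proof -
    have "path_image (curve (x,y)) = path_image (curve (a,b))" if "{x,y} = {a,b}" for x y
      using that curve(4)[OF ab] by (auto simp: doubleton_eq_iff)
    then have "{path_image (curve (x,y)) | x y. (x,y) \<in> parcs G \<and> {x,y} = {a,b}} = {path_image (curve (a,b))}"
      using ab by blast
    then show ?thesis by simp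
  qed
  have ex: "\<exists>a b. e = {a,b} \<and> (a,b) \<in> parcs G" if "e \<in> edge_sets G" for e
    using that unfolding edge_sets_def by blast
  show ?thesis
  proof
    show "finite (pverts G)" by (rule pair_finite_verts)
    show "inj_on pos (pverts G)" by (rule inj)
  next
    fix e assume "e \<in> edge_sets G"
    then obtain a b where "e = {a,b}" "(a,b) \<in> parcs G" using ex by blast
    then show "\<exists>a b. e = {a,b} \<and> a \<noteq> b \<and> a \<in> pverts G \<and> b \<in> pverts G"
      using no_loops' in_arcsD1 in_arcsD2 by blast
  next
    fix a b assume "{a,b} \<in> edge_sets G"
    then have ab: "(a,b) \<in> parcs G" by (simp add: edge_sets_iff)
    show "\<exists>g. Path_Connected.arc g \<and> pathstart g = pos a \<and> pathfinish g = pos b \<and> path_image g = ?img {a,b}"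
      unfolding img[OF ab] using curve(1-3)[OF ab] by blast
  next
    fix e assume "e \<in> edge_sets G"
    then obtain a b where e: "e = {a,b}" and ab: "(a,b) \<in> parcs G" using ex by blast
    show "?img e \<inter> pos ` pverts G = pos ` e" unfolding e img[OF ab] using curve(5)[OF ab] by simp
  next
    fix e e' assume "e \<in> edge_sets G" "e' \<in> edge_sets G" and ne: "e \<noteq> e'"
    then obtain a b c d where e: "e = {a,b}" "e' = {c,d}" and ab: "(a,b) \<in> parcs G" and cd: "(c,d) \<in> parcs G"
      using ex by metis
    show "?img e \<inter> ?img e' \<subseteq> pos ` (e \<inter> e')"
      unfolding e img[OF ab] img[OF cd] using disjoint[OF ab cd] ne e by simp
  qed
qed

theorem theorem2:
  fixes G :: "'a pair_pre_digraph"
  assumes "pair_graph G"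
    and "planar G"
    and "\<not> (\<exists>p. pre_digraph.cycle (with_proj G) p \<and> length p = 4)"
  shows "choosable TYPE('c) G 3 1"
  unfolding choosable_def
proof (intro allI impI, elim conjE)
  interpret pair_graph G by fact
  fix L :: "'a \<Rightarrow> 'c set"
  assume big: "\<forall>v\<in>pverts G. infinite (L v) \<or> 3 \<le> card (L v)"
    and sep: "\<forall>(x,y)\<in>parcs G. finite (L x \<inter> L y) \<and> card (L x \<inter> L y) \<le> 1"
  let ?E = "edge_sets G"
  have c4: "no_four_cycle ?E" by (rule edge_sets_no_four_cycle) fact
  obtain pos curve where "plane_drawing G pos curve" using assms(2) unfolding planar_def by blast
  note drawn = plane_drawing_drawn[OF this]
  (* Exactly three colours suffice; shrinking lists only shrinks their intersections. *)
  have "\<exists>S\<subseteq>L v. card S = 3" if "v \<in> pverts G" for v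
    using big that infinite_arbitrarily_large[of "L v" 3] obtain_subset_with_card_n[of 3 "L v"] by metis
  then obtain L' where L': "\<And>v. v \<in> pverts G \<Longrightarrow> L' v \<subseteq> L v \<and> card (L' v) = 3" by metis
  interpret list_graph "pverts G" ?E L'
  proof
    show "finite (pverts G)" by (rule pair_finite_verts)
    show "sparse (pverts G) ?E" by (rule drawn_hereditarily_sparse[OF drawn c4])
    show "T = T'" if "T \<in> triangles ?E" "T' \<in> triangles ?E" "e \<subseteq> T" "e \<subseteq> T'" "card e = 2" for T T' e
      by (rule no_four_cycle_tri_unique[OF c4 that])
    show "card (L' v) = 3" if "v \<in> pverts G" for v using L'[OF that] by blast
  next
    fix e assume "e \<in> ?E"
    then obtain x y where "e = {x,y}" "(x,y) \<in> parcs G" unfolding edge_sets_def by blast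
    then show "e \<subseteq> pverts G \<and> card e = 2" using no_loops'[of x y] in_arcsD1 in_arcsD2 by auto
  next
    fix x y \<beta> \<gamma> assume xy: "{x,y} \<in> ?E" and \<beta>: "\<beta> \<in> L' x \<inter> L' y" and \<gamma>: "\<gamma> \<in> L' x \<inter> L' y"
    have arc: "(x,y) \<in> parcs G" using xy by (simp add: edge_sets_iff)
    then have "finite (L x \<inter> L y)" "card (L x \<inter> L y) \<le> Suc 0" using sep by auto
    moreover have "L' x \<inter> L' y \<subseteq> L x \<inter> L y" using L' in_arcsD1[OF arc] in_arcsD2[OF arc] by blast
    ultimately show "\<beta> = \<gamma>" using \<beta> \<gamma> card_le_Suc0_iff_eq by blast
  qed
  obtain \<phi> where \<phi>: "\<forall>v\<in>pverts G. \<phi> v \<in> L' v" "\<forall>x y. {x,y} \<in> ?E \<longrightarrow> \<phi> x \<noteq> \<phi> y"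
    using list_colouring by blast
  have "list_coloring G L \<phi>" unfolding list_coloring_def
  proof (intro conjI ballI)
    fix v assume "v \<in> pverts G" then show "\<phi> v \<in> L v" using \<phi>(1) L' by blast
  next
    fix a assume "a \<in> parcs G"
    then show "case a of (x,y) \<Rightarrow> \<phi> x \<noteq> \<phi> y" using \<phi>(2) by (cases a) (simp add: edge_sets_iff)
  qed
  then show "\<exists>\<phi>. list_coloring G L \<phi>" by blast
qed

end
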